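(* Let $n\ge2$. Let $C=(\tau\overset{c}{\Rightarrow}\kappa)$ be a strong marked cover of symmetric $2n$-cores with marking $m(C)=c$. Assume that $\tau=\mathfrak{a}(w)$ and $\kappa=\mathfrak{a}(u)$ with $w,u\in\widetilde{C}_n^0$. Then $u=w\,t^c_{i,j}$ for some $i,j\in\mathbb{Z}\setminus(n+1)\mathbb{Z}$ (with $i\not\equiv j \pmod{2n+2}$, so that $t^c_{i,j}$ is defined) such that $$w(j)=u(i)=c+\left\lfloor \frac{c}{n}\right\rfloor+1 .$$
   Context: **The group.** $\widetilde{C}_n$ is the affine Weyl group of type C, with generators $s_0,s_1,\dots,s_n$ and relations $s_i^2=1$; $s_is_j=s_js_i$ if $|i-j|>1$; $s_is_{i+1}s_i=s_{i+1}s_is_{i+1}$ for $1\le i\le n-2$; $s_0s_1s_0s_1=s_1s_0s_1s_0$; $s_{n-1}s_ns_{n-1}s_n=s_ns_{n-1}s_ns_{n-1}$. $\ell(w)$ denotes the length of $w$ (number of letters in a shortest expression in the generators). It is realized (faithfully) as a group of permutations of $\mathbb{Z}$ under composition (congruences modulo $2n+2$): for $0<i<n$, $s_i(x)=x+1$ if $x\equiv i$ or $-i-1$, $s_i(x)=x-1$ if $x\equiv i+1$ or $-i$, and $s_i(x)=x$ otherwise; $s_0(x)=x+2$ if $x\equiv-1$, $x-2$ if $x\equiv1$, $x$ otherwise; $s_n(x)=x+2$ if $x\equiv n$, $x-2$ if $x\equiv n+2$, $x$ otherwise. $\widetilde{C}_n^0$ is the set of affine Grassmannian elements, i.e. the minimal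 length representatives of the cosets in $\widetilde{C}_n/C_n$ where $C_n=\langle s_1,\dots,s_n\rangle$. **Type C transpositions.** For $i,j\in\mathbb{Z}\setminus(n+1)\mathbb{Z}$ with $i\not\equiv j\pmod{2n+2}$, $t^c_{i,j}$ is the unique element of $\widetilde{C}_n$ such that for all $q\in\mathbb{Z}$: $i+q(2n+2)\mapsto j+q(2n+2)$, $j+q(2n+2)\mapsto i+q(2n+2)$, $-i+q(2n+2)\mapsto -j+q(2n+2)$, $-j+q(2n+2)\mapsto -i+q(2n+2)$, and all other integers are fixed. **Cores.** The Young diagram of a partition $\lambda$ is $\mathrm{dg}(\lambda)=\{(r,c)\in\mathbb{Z}_{\ge1}^2: c\le\lambda_r\}$ in French notation (row index $r$ increases from south to north, column index $c$ from west to east). The hook length of a box is the number of boxes strictly above it in its column plus the number weakly to its right in its row (including itself). A $2n$-core is a partition whose diagram has no box of hook length $2n$. $\mathcal{C}_{2n}^c$ denotes the set of symmetric $2n$-cores ($(i,j)\in\mathrm{dg}(\kappa)$ iff $(j,i)\in\mathrm{dg}(\kappa)$). The content of a box $(i,j)$ is $j-i$; its residue is its content modulo $2n$. An addable (removable) corner of $\lambda$ is a box outside (inside) $\mathrm{dg}(\lambda)$ whose addition (removal) gives the diagram of a partition. **Action and bijection.** $\widetilde{C}_n$ acts on $\mathcal{C}_{2n}^c$ by (for $i\in[0,n]$): if $\kappa$ has at least one addable corner of residue $i$, then $s_i\cdot\kappa$ is obtained by adding all addable corners of residue $i$ or $2n-i$ modulo $2n$; if $\kappa$ has at least one removable corner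 of residue $i$, then $s_i\cdot\kappa$ is obtained by removing all removable corners of residue $i$ or $2n-i$ modulo $2n$; otherwise $s_i\cdot\kappa=\kappa$. It is known that this is a well-defined group action and that $\mathfrak{a}:\widetilde{C}_n^0\to\mathcal{C}_{2n}^c$, $w\mapsto w\cdot\emptyset$, is a bijection. **Strong marked covers.** For $\tau,\kappa\in\mathcal{C}_{2n}^c$, $\tau\Rightarrow\kappa$ is a strong cover if $\mathrm{dg}(\tau)\subset\mathrm{dg}(\kappa)$ and $\ell(\mathfrak{a}^{-1}(\kappa))=\ell(\mathfrak{a}^{-1}(\tau))+1$. In this case it is known that $\kappa/\tau=\mathrm{dg}(\kappa)\setminus\mathrm{dg}(\tau)$ is a collection of disjoint ribbons (its connected components, where boxes are connected by sharing edges; a ribbon is a connected set of boxes containing no $2\times2$ square). A strong marked cover $\tau\overset{c}{\Rightarrow}\kappa$ is a strong cover $\tau\Rightarrow\kappa$ together with an integer $c$ (the marking) that is the content of the most southeast box of one of the ribbons of $\kappa/\tau$. *)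

theory Defs
  imports Complex_Main "HOL-Number_Theory.Cong" "HOL-Algebra.Bij" "HOL-Algebra.Generated_Groups"
begin

section \<open>The affine Weyl group of type C as permutations of the integers\<close>

definition sgen :: "nat \<Rightarrow> nat \<Rightarrow> int \<Rightarrow> int" where
  "sgen n i x =
    (let m = 2 * int n + 2; k = int i in
     if i = 0 then
       (if [x = -1] (mod m) then x + 2 else if [x = 1] (mod m) then x - 2 else x)
     else if i = n then
       (if [x = int n] (mod m) then x + 2 else if [x = int n + 2] (mod m) then x - 2 else x)
     else
       (if [x = k] (mod m) \<or> [x = - k - 1] (mod m) then x + 1
        else if [x = k + 1] (mod m) \<or> [x = - k] (mod m) then x - 1
        else x))"

definition affC :: "nat \<Rightarrow> (int \<Rightarrow> int) set" where
  "affC n = generate (BijGroup UNIV) (sgen n ` {0..n})"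

definition finC :: "nat \<Rightarrow> (int \<Rightarrow> int) set" where
  "finC n = generate (BijGroup UNIV) (sgen n ` {1..n})"

definition word_perm :: "nat \<Rightarrow> nat list \<Rightarrow> int \<Rightarrow> int" where
  "word_perm n ws = foldr (\<lambda>i f. sgen n i \<circ> f) ws id"

definition is_word :: "nat \<Rightarrow> nat list \<Rightarrow> (int \<Rightarrow> int) \<Rightarrow> bool" where
  "is_word n ws w \<longleftrightarrow> set ws \<subseteq> {0..n} \<and> word_perm n ws = w"

definition cox_length :: "nat \<Rightarrow> (int \<Rightarrow> int) \<Rightarrow> nat" where
  "cox_length n w = (LEAST k. \<exists>ws. is_word n ws w \<and> length ws = k)"

definition affC0 :: "nat \<Rightarrow> (int \<Rightarrow> int) set" where
  "affC0 n = {w \<in> affC n.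
     \<forall>v \<in> w <#\<^bsub>BijGroup UNIV\<^esub> finC n. cox_length n w \<le> cox_length n v}"

definition tC :: "nat \<Rightarrow> int \<Rightarrow> int \<Rightarrow> int \<Rightarrow> int" where
  "tC n i j = (THE t. t \<in> affC n \<and>
     (let m = 2 * int n + 2 in
       (\<forall>q. t (i + q * m) = j + q * m \<and> t (j + q * m) = i + q * m \<and>
            t (- i + q * m) = - j + q * m \<and> t (- j + q * m) = - i + q * m) \<and>
       (\<forall>x. \<not> [x = i] (mod m) \<and> \<not> [x = j] (mod m) \<and>
            \<not> [x = - i] (mod m) \<and> \<not> [x = - j] (mod m) \<longrightarrow> t x = x)))"


section \<open>Partitions and cores\<close>

type_synonym box = "nat \<times> nat"

text \<open>A partition is the list of its parts; a box is a pair (row, column), both counted from 1,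
  with row 1 the southernmost one.\<close>

definition is_partition :: "nat list \<Rightarrow> bool" where
  "is_partition \<mu> \<longleftrightarrow> sorted_wrt (\<ge>) \<mu> \<and> 0 \<notin> set \<mu>"

definition dg :: "nat list \<Rightarrow> box set" where
  "dg \<mu> = {(r, c). 1 \<le> r \<and> r \<le> length \<mu> \<and> 1 \<le> c \<and> c \<le> \<mu> ! (r - 1)}"

definition is_diagram :: "box set \<Rightarrow> bool" where
  "is_diagram D \<longleftrightarrow> (\<exists>\<mu>. is_partition \<mu> \<and> dg \<mu> = D)"

definition partition_of :: "box set \<Rightarrow> nat list" where
  "partition_of D = (THE \<mu>. is_partition \<mu> \<and> dg \<mu> = D)"

definition hook_length :: "nat list \<Rightarrow> box \<Rightarrow> nat" where
  "hook_length \<mu> b =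
     card {r. fst b < r \<and> (r, snd b) \<in> dg \<mu>} + card {c. snd b \<le> c \<and> (fst b, c) \<in> dg \<mu>}"

definition is_core :: "nat \<Rightarrow> nat list \<Rightarrow> bool" where
  "is_core p \<mu> \<longleftrightarrow> is_partition \<mu> \<and> (\<forall>b \<in> dg \<mu>. hook_length \<mu> b \<noteq> p)"

definition sym_cores :: "nat \<Rightarrow> nat list set" where
  "sym_cores n = {\<kappa>. is_core (2 * n) \<kappa> \<and> (\<forall>i j. (i, j) \<in> dg \<kappa> \<longleftrightarrow> (j, i) \<in> dg \<kappa>)}"

definition content :: "box \<Rightarrow> int" where
  "content b = int (snd b) - int (fst b)"

definition addable :: "nat list \<Rightarrow> box set" where
  "addable \<mu> = {b. b \<notin> dg \<mu> \<and> is_diagram (insert b (dg \<mu>))}"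

definition removable :: "nat list \<Rightarrow> box set" where
  "removable \<mu> = {b. b \<in> dg \<mu> \<and> is_diagram (dg \<mu> - {b})}"


section \<open>The action on cores\<close>

definition has_residue :: "nat \<Rightarrow> nat \<Rightarrow> box \<Rightarrow> bool" where
  "has_residue n i b \<longleftrightarrow> [content b = int i] (mod 2 * int n)"

definition has_residue_pm :: "nat \<Rightarrow> nat \<Rightarrow> box \<Rightarrow> bool" where
  "has_residue_pm n i b \<longleftrightarrow>
     [content b = int i] (mod 2 * int n) \<or> [content b = 2 * int n - int i] (mod 2 * int n)"

definition act_gen :: "nat \<Rightarrow> nat \<Rightarrow> nat list \<Rightarrow> nat list" where
  "act_gen n i \<kappa> =
    (if \<exists>b \<in> addable \<kappa>. has_residue n i b then
       partition_of (dg \<kappa> \<union> {b \<in> addable \<kappa>. has_residue_pm n i b})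
     else if \<exists>b \<in> removable \<kappa>. has_residue n i b then
       partition_of (dg \<kappa> - {b \<in> removable \<kappa>. has_residue_pm n i b})
     else \<kappa>)"

text \<open>A group element acts through an arbitrary word representing it. On symmetric cores the
  result does not depend on the word, because the operators \<^const>\<open>act_gen\<close> satisfy the Coxeter
  relations there.\<close>

definition act :: "nat \<Rightarrow> (int \<Rightarrow> int) \<Rightarrow> nat list \<Rightarrow> nat list" where
  "act n w \<kappa> = foldr (act_gen n) (SOME ws. is_word n ws w) \<kappa>"

definition core_of :: "nat \<Rightarrow> (int \<Rightarrow> int) \<Rightarrow> nat list" where
  "core_of n w = act n w []"

definition elt_of_core :: "nat \<Rightarrow> nat list \<Rightarrow> (int \<Rightarrow> int)" where
  "elt_of_core n = inv_into (affC0 n) (core_of n)"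


section \<open>Strong marked covers\<close>

definition strong_cover :: "nat \<Rightarrow> nat list \<Rightarrow> nat list \<Rightarrow> bool" where
  "strong_cover n \<tau> \<kappa> \<longleftrightarrow>
     \<tau> \<in> sym_cores n \<and> \<kappa> \<in> sym_cores n \<and> dg \<tau> \<subset> dg \<kappa> \<and>
     cox_length n (elt_of_core n \<kappa>) = cox_length n (elt_of_core n \<tau>) + 1"

definition adjacent :: "box \<Rightarrow> box \<Rightarrow> bool" where
  "adjacent a b \<longleftrightarrow>
     (fst a = fst b \<and> (snd b = Suc (snd a) \<or> snd a = Suc (snd b))) \<or>
     (snd a = snd b \<and> (fst b = Suc (fst a) \<or> fst a = Suc (fst b)))"

definition box_components :: "box set \<Rightarrow> box set set" where
  "box_components S =
     {{b. (a, b) \<in> {(x, y). x \<in> S \<and> y \<in> S \<and> adjacent x y}\<^sup>*} | a. a \<in> S}"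

definition most_southeast :: "box set \<Rightarrow> box \<Rightarrow> bool" where
  "most_southeast R b \<longleftrightarrow> b \<in> R \<and> (\<forall>b' \<in> R. fst b \<le> fst b' \<and> snd b' \<le> snd b)"

text \<open>For a strong cover, the connected components of the skew diagram are ribbons, so the
  ribbons that can be marked are exactly the components.\<close>

definition strong_marked_cover :: "nat \<Rightarrow> nat list \<Rightarrow> int \<Rightarrow> nat list \<Rightarrow> bool" where
  "strong_marked_cover n \<tau> c \<kappa> \<longleftrightarrow> strong_cover n \<tau> \<kappa> \<and>
     (\<exists>R \<in> box_components (dg \<kappa> - dg \<tau>). \<exists>b. most_southeast R b \<and> c = content b)"

end

(*
  Identify the contents (the integers) with the integers not divisible by n + 1 by the order
  isomorphism c \<mapsto> c + \<lfloor>c / n\<rfloor> + 1. Encode a diagram by the number of boxes on each of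
  its diagonals; the increments of this function form a sequence of beads and gaps, and the core of
  w has its beads at the positions in the image of the negative integers under w. A generator
  swaps adjacent positions, and the most southeast box of a component of \<kappa>/\<tau> has a content
  which is a bead of \<kappa> and a gap of \<tau>. Hence it suffices that w\<inverse> u is a reflection: it then
  exchanges the preimage of that position under u (negative) with the one under w (positive).

  That w\<inverse> u is a reflection is shown without the Bruhat order, by induction on the length
  of u. Removing all removable boxes of a residue is monotone with respect to containment. So if a is
  the first letter of a reduced word of u, then a can either be cancelled from both u and w, or
  the core of w is contained in the core of a u, in which case equality of lengths forces w = a u.
*)

theory Submission
  imports Defs
begin

section \<open>Contents and wall crossings\<close>

text \<open>Each of the generators \<open>s_1\<close>, ..., \<open>s_n\<close> preserves the sign of
  every integer, so the image of the negative integers under \<open>w\<close> depends only on the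
  coset of \<open>w\<close>; left multiplication by a generator merely moves beads. The obstacle is
  that containment of cores is not a relation defined by multiplication. The induction must
  therefore carry more than the statement about covers: containment bounds the length, and equal
  lengths occur only for equal elements. This is what identifies \<open>w\<close> once a box has
  been removed from the larger core alone. The reflection is carried as a conjugate of a generator,
  because the quotient of the two elements does not change when the same letter is cancelled on the
  left of both. It has many names \<open>i\<close>, \<open>j\<close>; only at the end does the
  marking select one. Length is a minimum over words and is controlled by an exchange argument for a
  single letter. The action is defined through an arbitrarily chosen word, so the description by
  beads is proved for every word.\<close>

definition skip :: "nat \<Rightarrow> int \<Rightarrow> int" where
  "skip n x = x + x div int n + 1"

text \<open>\<open>wall n i x\<close> means that the generator \<open>s\<^sub>i\<close> exchanges the positions \<open>x - 1\<close> and \<open>x\<close>, so that a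
  box which it adds or removes has content \<open>x\<close>.\<close>

definition wall :: "nat \<Rightarrow> nat \<Rightarrow> int \<Rightarrow> bool" where
  "wall n i x \<longleftrightarrow> 2 * int n dvd x - int i \<or> 2 * int n dvd x + int i"

text \<open>A generator transported to contents. The order of the two tests is immaterial by
  \<open>wall_not_adjacent\<close>.\<close>

definition swap :: "nat \<Rightarrow> nat \<Rightarrow> int \<Rightarrow> int" where
  "swap n i x = (if wall n i x then x - 1 else if wall n i (x + 1) then x + 1 else x)"

section \<open>Integer arithmetic of \<open>skip\<close>\<close>

lemma dvd_small_iff:
  fixes M a :: int
  assumes "- M < a" "a < M"
  shows "M dvd a \<longleftrightarrow> a = 0"
  using assms zdvd_not_zless[of a M] zdvd_not_zless[of "- a" M] by fastforce

lemma dvd_double_iff: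
  fixes M a :: int
  assumes "0 \<le> a" "a < 2 * M"
  shows "M dvd a \<longleftrightarrow> a = 0 \<or> a = M"
proof (cases "a < M")
  case True
  then show ?thesis using assms dvd_small_iff[of M a] by auto
next
  case False
  have "M dvd a \<longleftrightarrow> M dvd a - M" by (simp add: dvd_diff_left_iff)
  also have "\<dots> \<longleftrightarrow> a = M" using False assms dvd_small_iff[of M "a - M"] by auto
  finally show ?thesis using False assms by auto
qed

lemma skip_eqI: "x = int n * q + r \<Longrightarrow> 0 \<le> r \<Longrightarrow> r < int n \<Longrightarrow> skip n x = (int n + 1) * q + r + 1"
  unfolding skip_def by (subst int_div_pos_eq[of x "int n" q r]) (auto simp: algebra_simps)

lemma skip_add: "n > 0 \<Longrightarrow> skip n (x + int n * k) = skip n x + (int n + 1) * k"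
  by (simp add: skip_def algebra_simps)

lemma skip_period: "n > 0 \<Longrightarrow> skip n (x + 2 * int n * k) = skip n x + (2 * int n + 2) * k"
  using skip_add[of n x "2 * k"] by (simp add: algebra_simps)

lemma div_mod_cases:
  fixes x :: int
  assumes "d > 0"
  obtains q r where "x = d * q + r" "0 \<le> r" "r < d"
  using assms that[of "x div d" "x mod d"] by simp

text \<open>Negation in the range of \<open>skip\<close> fixes only the omitted value 0, so on
  contents it becomes the reflection about -1/2.\<close>

lemma skip_reflect:
  assumes "n > 0"
  shows "skip n (- 1 - x) = - skip n x"
proof -
  obtain q r where x: "x = int n * q + r" "0 \<le> r" "r < int n"
    using div_mod_cases[of "int n" x] assms by auto
  have "skip n (- 1 - x) = (int n + 1) * (- 1 - q) + (int n - 1 - r) + 1"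
    by (rule skip_eqI) (use x in \<open>auto simp: algebra_simps\<close>)
  then show ?thesis using skip_eqI[OF x] by (simp add: algebra_simps)
qed

lemma skip_less:
  assumes "n > 0" "x < y"
  shows "skip n x < skip n y"
  using assms zdiv_mono1[of x y "int n"] by (simp add: skip_def)

lemma skip_less_iff: "n > 0 \<Longrightarrow> skip n x < skip n y \<longleftrightarrow> x < y"
  using skip_less[of n x y] skip_less[of n y x] by (cases x y rule: linorder_cases) auto

lemma skip_eq_iff: "n > 0 \<Longrightarrow> skip n x = skip n y \<longleftrightarrow> x = y"
  using skip_less[of n x y] skip_less[of n y x] by (cases x y rule: linorder_cases) auto

lemma not_dvd_skip:
  assumes "n > 0"
  shows "\<not> (int n + 1) dvd skip n x"
proof -
  obtain q r where x: "x = int n * q + r" "0 \<le> r" "r < int n"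
    using div_mod_cases[of "int n" x] assms by auto
  have "(int n + 1) dvd skip n x \<longleftrightarrow> (int n + 1) dvd r + 1"
    unfolding skip_eqI[OF x] by (metis add.assoc dvd_add_right_iff dvd_triv_left)
  then show ?thesis using x dvd_small_iff[of "int n + 1" "r + 1"] by auto
qed

lemma int_skip_cases:
  fixes y :: int
  assumes "n > 0"
  obtains (skip) x where "y = skip n x" | (mult) k where "y = (int n + 1) * k"
proof -
  obtain q r where y: "y = (int n + 1) * q + r" "0 \<le> r" "r < int n + 1"
    using div_mod_cases[of "int n + 1" y] assms by auto
  show thesis
  proof (cases "r = 0")
    case True
    then show ?thesis using y mult by simp
  next
    case False
    then have "skip n (int n * q + (r - 1)) = y"
      using y by (subst skip_eqI[of _ n q "r - 1"]) auto
    then show ?thesis using skip by metis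
  qed
qed

section \<open>Walls of a generator\<close>

lemma wall_residue:
  assumes "i \<le> n" "0 \<le> s" "s < 2 * int n"
  shows "wall n i (2 * int n * k + s) \<longleftrightarrow> s = int i \<or> s + int i = 2 * int n \<or> s + int i = 0"
proof -
  have "2 * int n dvd 2 * int n * k + s - int i \<longleftrightarrow> 2 * int n dvd s - int i"
    by (metis add_diff_eq dvd_add_right_iff dvd_triv_left)
  moreover have "2 * int n dvd 2 * int n * k + s + int i \<longleftrightarrow> 2 * int n dvd s + int i"
    by (metis add.assoc dvd_add_right_iff dvd_triv_left)
  moreover have "2 * int n dvd s - int i \<longleftrightarrow> s - int i = 0"
    using assms by (intro dvd_small_iff) auto
  moreover have "2 * int n dvd s + int i \<longleftrightarrow> s + int i = 0 \<or> s + int i = 2 * int n"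
    using assms by (intro dvd_double_iff) auto
  ultimately show ?thesis unfolding wall_def by auto
qed

lemma wall_period: "wall n i (x + 2 * int n * k) \<longleftrightarrow> wall n i x"
proof -
  have "x + 2 * int n * k - int i = (x - int i) + 2 * int n * k"
    "x + 2 * int n * k + int i = (x + int i) + 2 * int n * k" by auto
  then show ?thesis unfolding wall_def by (metis dvd_add_left_iff dvd_triv_left)
qed

lemma wall_uminus: "wall n i (- x) \<longleftrightarrow> wall n i x"
proof -
  have "2 * int n dvd - x - int i \<longleftrightarrow> 2 * int n dvd x + int i"
    by (metis dvd_minus_iff minus_diff_eq diff_minus_eq_add uminus_add_conv_diff add.commute)
  moreover have "2 * int n dvd - x + int i \<longleftrightarrow> 2 * int n dvd x - int i"
    by (metis dvd_minus_iff minus_diff_eq uminus_add_conv_diff)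
  ultimately show ?thesis unfolding wall_def by auto
qed

text \<open>Two walls of one generator differ by 0, \<open>2 * i\<close> or \<open>- 2 * i\<close>
  modulo \<open>2 * n\<close>, hence by an even number. So the exchanges made by a generator are
  disjoint.\<close>

lemma wall_not_adjacent:
  assumes "n \<ge> 2" "wall n i x"
  shows "\<not> wall n i (x + 1)"
proof
  assume "wall n i (x + 1)"
  have no1: "\<not> 2 * int n dvd 1" using assms(1) by auto
  have odd: "\<not> 2 * int n dvd 1 + 2 * z" for z
  proof
    assume "2 * int n dvd 1 + 2 * z"
    then have "2 dvd 1 + 2 * z" using dvd_mult_left by blast
    then show False by simp
  qed
  have "2 * int n dvd (x + 1 - int i) - (x - int i) \<or> 2 * int n dvd (x + 1 + int i) - (x + int i)
    \<or> 2 * int n dvd (x + 1 + int i) - (x - int i) \<or> 2 * int n dvd (x + 1 - int i) - (x + int i)"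
    using assms(2) \<open>wall n i (x + 1)\<close> unfolding wall_def by (meson dvd_diff)
  moreover have "(x + 1 - int i) - (x - int i) = 1" "(x + 1 + int i) - (x + int i) = 1"
    "(x + 1 + int i) - (x - int i) = 1 + 2 * int i"
    "(x + 1 - int i) - (x + int i) = 1 + 2 * (- int i)" by auto
  ultimately show False using no1 odd by metis
qed

text \<open>The walls of one generator form one orbit under negation and translation by
  \<open>2 * n\<close>, so symmetric statements transfer from one wall to all of them.\<close>

lemma wall_cases:
  assumes "wall n i x" "wall n i y"
  obtains k where "y = x + 2 * int n * k" | k where "y = - x + 2 * int n * k"
proof -
  have "2 * int n dvd (y - int i) - (x - int i) \<or> 2 * int n dvd (y + int i) - (x + int i)
    \<or> 2 * int n dvd (y + int i) + (x - int i) \<or> 2 * int n dvd (y - int i) + (x + int i)"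
    using assms unfolding wall_def by (meson dvd_diff dvd_add)
  then have "2 * int n dvd y - x \<or> 2 * int n dvd y + x" by (simp add: algebra_simps)
  then show thesis
  proof
    assume "2 * int n dvd y - x"
    then obtain k where "y - x = 2 * int n * k" by (elim dvdE)
    then show thesis using that(1)[of k] by simp
  next
    assume "2 * int n dvd y + x"
    then obtain k where "y + x = 2 * int n * k" by (elim dvdE)
    then show thesis using that(2)[of k] by simp
  qed
qed

section \<open>Generators as swaps of neighbouring contents\<close>

lemma swap_swap: "n \<ge> 2 \<Longrightarrow> swap n i (swap n i x) = x"
  using wall_not_adjacent[of n i x] wall_not_adjacent[of n i "x - 1"]
    wall_not_adjacent[of n i "x + 1"] by (auto simp: swap_def)

lemma swap_period: "swap n i (x + 2 * int n * k) = swap n i x + 2 * int n * k"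
proof -
  have "wall n i (x + 2 * int n * k + 1) \<longleftrightarrow> wall n i (x + 1)"
    using wall_period[of n i "x + 1" k] by (simp only: ac_simps)
  then show ?thesis unfolding swap_def wall_period by simp
qed

lemma swap_reflect:
  assumes "n \<ge> 2"
  shows "swap n i (- 1 - x) = - 1 - swap n i x"
proof -
  have "wall n i (- 1 - x) \<longleftrightarrow> wall n i (x + 1)"
    using wall_uminus[of n i "x + 1"] by (simp add: algebra_simps)
  moreover have "wall n i (- 1 - x + 1) \<longleftrightarrow> wall n i x"
    using wall_uminus[of n i x] by simp
  ultimately show ?thesis using wall_not_adjacent[OF assms, of i x] by (auto simp: swap_def)
qed

text \<open>The range exceeds one period by one at each end because \<open>swap\<close> may push a
  residue to -1 or to \<open>2 * n\<close>.\<close>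

lemma skip_residue:
  assumes "n > 0" "- 1 \<le> s" "s \<le> 2 * int n"
  shows "skip n (2 * int n * k + s) = (2 * int n + 2) * k +
    (if s < 0 then s else if s < int n then s + 1 else if s < 2 * int n then s + 2 else s + 3)"
proof -
  have a: "skip n (2 * int n * k + s) = skip n s + (2 * int n + 2) * k"
    using skip_period[of n s k] assms by (simp add: add.commute)
  have "skip n s = (if s < 0 then s else if s < int n then s + 1
    else if s < 2 * int n then s + 2 else s + 3)"
    using assms skip_eqI[of s n 0 s] skip_eqI[of s n 1 "s - int n"] skip_eqI[of s n 2 "s - 2 * int n"]
      skip_eqI[of s n "- 1" "s + int n"] by auto
  then show ?thesis using a by simp
qed

lemma cong_residue:
  fixes M k s j :: int
  assumes "0 \<le> s" "s < M" "- M \<le> j" "j < M"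
  shows "[M * k + s = j] (mod M) \<longleftrightarrow> s = j \<or> s = j + M"
proof -
  have "[M * k + s = j] (mod M) \<longleftrightarrow> M dvd M * k + (s - j)"
    by (simp add: cong_iff_dvd_diff add_diff_eq)
  also have "\<dots> \<longleftrightarrow> M dvd s - j" by (rule dvd_add_right_iff) simp
  also have "\<dots> \<longleftrightarrow> s = j \<or> s = j + M"
  proof (cases "j \<ge> 0")
    case True
    then show ?thesis using assms dvd_small_iff[of M "s - j"] by auto
  next
    case False
    then show ?thesis using assms dvd_double_iff[of "s - j" M] by auto
  qed
  finally show ?thesis .
qed

lemma sgen_residue:
  fixes n i :: nat and s k :: int
  assumes "0 \<le> s" "s < 2 * int n + 2" "i \<le> n" "n > 0"
  shows "sgen n i ((2 * int n + 2) * k + s) = (2 * int n + 2) * k +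
    (if i = 0 then (if s = 2 * int n + 1 then s + 2 else if s = 1 then s - 2 else s)
     else if i = n then (if s = int n then s + 2 else if s = int n + 2 then s - 2 else s)
     else (if s = int i \<or> s = 2 * int n + 1 - int i then s + 1
        else if s = int i + 1 \<or> s = 2 * int n + 2 - int i then s - 1 else s))"
proof -
  define X where "X = (2 * int n + 2) * k + s"
  have C: "[X = j] (mod 2 * int n + 2) \<longleftrightarrow> s = j \<or> s = j + (2 * int n + 2)"
    if "- (2 * int n + 2) \<le> j" "j < 2 * int n + 2" for j
    unfolding X_def by (rule cong_residue) (use assms that in auto)
  have K: "(2 * int n + 2) * k = X - s" by (simp add: X_def)
  show ?thesis
    unfolding X_def[symmetric] K using assms by (auto simp: sgen_def Let_def C)
qed

text \<open>The core of \<open>sgen_skip\<close> as linear arithmetic over one period: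
  \<open>e\<close> is the \<open>skip\<close> value of the residue \<open>s\<close>, and
  \<open>t\<close> is the residue after the swap. The six cases fix the kind of generator and the
  half of the period.\<close>

lemma swap_table:
  fixes s N i :: int
  defines "e \<equiv> if s < N then s + 1 else s + 2"
  defines "t \<equiv> if s = i \<or> s + i = 2 * N \<or> s + i = 0 then s - 1
    else if s + 1 = i \<or> s + 1 + i = 2 * N \<or> (s + 1 = 2 * N \<and> i = 0) then s + 1 else s"
  assumes "0 \<le> s" "s < 2 * N" "0 \<le> i" "i \<le> N" "2 \<le> N"
  shows "(if i = 0 then (if e = 2 * N + 1 then e + 2 else if e = 1 then e - 2 else e)
     else if i = N then (if e = N then e + 2 else if e = N + 2 then e - 2 else e)
     else (if e = i \<or> e = 2 * N + 1 - i then e + 1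
        else if e = i + 1 \<or> e = 2 * N + 2 - i then e - 1 else e))
    = (if t < 0 then t else if t < N then t + 1 else if t < 2 * N then t + 2 else t + 3)"
proof -
  consider "i = 0" "s < N" | "i = 0" "s \<ge> N" | "i = N" "s < N" | "i = N" "s \<ge> N"
    | "i \<noteq> 0" "i \<noteq> N" "s < N" | "i \<noteq> 0" "i \<noteq> N" "s \<ge> N" by linarith
  then show ?thesis
  proof cases
    case 1
    then show ?thesis using assms(3-) unfolding e_def t_def by auto
  next
    case 2
    then show ?thesis using assms(3-) unfolding e_def t_def by auto
  next
    case 3
    then show ?thesis using assms(3-) unfolding e_def t_def by auto
  next
    case 4
    then show ?thesis using assms(3-) unfolding e_def t_def by auto
  next
    case 5
    then show ?thesis using assms(3-) unfolding e_def t_def by auto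
  next
    case 6
    then show ?thesis using assms(3-) unfolding e_def t_def by auto
  qed
qed

text \<open>The first and last generators move points by 2 because a multiple of
  \<open>n + 1\<close> lies between the exchanged points; \<open>skip\<close> leaves it out, so all
  generators become swaps of neighbours.\<close>

lemma sgen_skip:
  assumes "n \<ge> 2" "i \<le> n"
  shows "sgen n i (skip n x) = skip n (swap n i x)"
proof -
  obtain k s where x: "x = 2 * int n * k + s" "0 \<le> s" "s < 2 * int n"
    using div_mod_cases[of "2 * int n" x] assms by auto
  have w: "wall n i x \<longleftrightarrow> s = int i \<or> s + int i = 2 * int n \<or> s + int i = 0"
    using wall_residue[OF assms(2) x(2,3)] x(1) by simp
  have w1: "wall n i (x + 1) \<longleftrightarrow> s + 1 = int i \<or> s + 1 + int i = 2 * int n \<or>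
      (s + 1 = 2 * int n \<and> i = 0)"
  proof (cases "s + 1 = 2 * int n")
    case True
    then have "x + 1 = 2 * int n * (k + 1) + 0" using x by (simp add: algebra_simps)
    then show ?thesis using wall_residue[OF assms(2), of 0 "k + 1"] assms True by auto
  next
    case False
    then have "x + 1 = 2 * int n * k + (s + 1)" using x by (simp add: algebra_simps)
    then show ?thesis by (simp only:) (subst wall_residue, use False x assms in auto)
  qed
  define e where "e = (if s < int n then s + 1 else s + 2)"
  define t where "t = (if s = int i \<or> s + int i = 2 * int n \<or> s + int i = 0 then s - 1
    else if s + 1 = int i \<or> s + 1 + int i = 2 * int n \<or> (s + 1 = 2 * int n \<and> int i = 0)
      then s + 1 else s)"
  have e: "0 \<le> e" "e < 2 * int n + 2" using x by (auto simp: e_def)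
  have t: "- 1 \<le> t" "t \<le> 2 * int n" using x by (auto simp: t_def)
  have "skip n x = (2 * int n + 2) * k + e"
    using skip_residue[of n s k] x assms by (auto simp: e_def)
  then have "sgen n i (skip n x) = (2 * int n + 2) * k +
    (if int i = 0 then (if e = 2 * int n + 1 then e + 2 else if e = 1 then e - 2 else e)
     else if int i = int n then (if e = int n then e + 2 else if e = int n + 2 then e - 2 else e)
     else (if e = int i \<or> e = 2 * int n + 1 - int i then e + 1
        else if e = int i + 1 \<or> e = 2 * int n + 2 - int i then e - 1 else e))"
    using sgen_residue[OF e assms(2), of k] assms(1) by simp
  also have "\<dots> = (2 * int n + 2) * k +
    (if t < 0 then t else if t < int n then t + 1 else if t < 2 * int n then t + 2 else t + 3)"
    unfolding e_def t_def by (subst swap_table) (use x assms in auto)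
  also have "\<dots> = skip n (2 * int n * k + t)"
    using skip_residue[OF _ t, of k] assms by simp
  also have "2 * int n * k + t = swap n i x"
    unfolding swap_def w w1 t_def using x(1) by simp
  finally show ?thesis .
qed

lemma sgen_mult:
  assumes "n \<ge> 2" "i \<le> n"
  shows "sgen n i ((int n + 1) * k) = (int n + 1) * k"
proof -
  obtain l e where k: "k = 2 * l + e" "0 \<le> e" "e < 2" using div_mod_cases[of 2 k] by auto
  then have "e = 0 \<or> e = 1" by auto
  then show ?thesis
    using sgen_residue[of "(int n + 1) * e" n i l] assms k by (auto simp: algebra_simps)
qed

section \<open>Words, exchange and Grassmannian elements\<close>

abbreviation perm_inv :: "(int \<Rightarrow> int) \<Rightarrow> int \<Rightarrow> int" where
  "perm_inv w \<equiv> inv_into UNIV w"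

text \<open>The symmetries shared by all group elements. They are stable under composition and
  inverse, so conjugates can be handled without words.\<close>

definition equivariant :: "nat \<Rightarrow> (int \<Rightarrow> int) \<Rightarrow> bool" where
  "equivariant n w \<longleftrightarrow> bij w \<and> (\<forall>x. w (x + (2 * int n + 2)) = w x + (2 * int n + 2)) \<and>
     (\<forall>x. w (- x) = - w x)"

text \<open>The pointwise condition inside \<open>tC\<close>, separated from membership in the group
  so that it can be conjugated and compared on its own.\<close>

definition is_transposition :: "nat \<Rightarrow> (int \<Rightarrow> int) \<Rightarrow> int \<Rightarrow> int \<Rightarrow> bool" where
  "is_transposition n t i j \<longleftrightarrow>
     (let m = 2 * int n + 2 in
       (\<forall>q. t (i + q * m) = j + q * m \<and> t (j + q * m) = i + q * m \<and>
            t (- i + q * m) = - j + q * m \<and> t (- j + q * m) = - i + q * m) \<and>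
       (\<forall>x. \<not> [x = i] (mod m) \<and> \<not> [x = j] (mod m) \<and>
            \<not> [x = - i] (mod m) \<and> \<not> [x = - j] (mod m) \<longrightarrow> t x = x))"

section \<open>Permutations compatible with translation and negation\<close>

lemma equivariant_bij: "equivariant n w \<Longrightarrow> bij w"
  by (simp add: equivariant_def)

lemma equivariant_uminus: "equivariant n w \<Longrightarrow> w (- x) = - w x"
  by (simp add: equivariant_def)

lemma equivariant_add:
  assumes "equivariant n w"
  shows "w (x + q * (2 * int n + 2)) = w x + q * (2 * int n + 2)"
proof (induction q arbitrary: x rule: int_induct[where k = 0])
  case base
  then show ?case by simp
next
  case (step1 q)
  have "w (x + (q + 1) * (2 * int n + 2)) = w ((x + q * (2 * int n + 2)) + (2 * int n + 2))"
    by (simp add: algebra_simps)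
  also have "\<dots> = w (x + q * (2 * int n + 2)) + (2 * int n + 2)"
    using assms unfolding equivariant_def by blast
  finally show ?case using step1 by (simp add: algebra_simps)
next
  case (step2 q)
  have "w (x + q * (2 * int n + 2)) = w ((x + (q - 1) * (2 * int n + 2)) + (2 * int n + 2))"
    by (simp add: algebra_simps)
  also have "\<dots> = w (x + (q - 1) * (2 * int n + 2)) + (2 * int n + 2)"
    using assms unfolding equivariant_def by blast
  finally show ?case using step2 by (simp add: algebra_simps)
qed

lemma equivariant_id: "equivariant n id"
  by (simp add: equivariant_def)

lemma equivariant_comp: "equivariant n v \<Longrightarrow> equivariant n w \<Longrightarrow> equivariant n (v \<circ> w)"
  by (simp add: equivariant_def bij_comp)

lemma inv_comp_bij: "bij w \<Longrightarrow> perm_inv w \<circ> w = id" "bij w \<Longrightarrow> w \<circ> perm_inv w = id"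
  by (auto simp: fun_eq_iff bij_is_inj bij_is_surj surj_f_inv_f)

lemma equivariant_inv:
  assumes "equivariant n w"
  shows "equivariant n (perm_inv w)"
proof -
  have b: "bij w" using assms by (simp add: equivariant_def)
  have eq: "perm_inv w y = x \<longleftrightarrow> y = w x" for x y
    using b by (metis bij_inv_eq_iff)
  have s: "w (perm_inv w x) = x" for x using b by (simp add: bij_is_surj surj_f_inv_f)
  show ?thesis unfolding equivariant_def
    using b assms by (auto simp: bij_imp_bij_inv eq s equivariant_def)
qed

text \<open>A multiple \<open>x\<close> of \<open>n + 1\<close> is congruent to \<open>- x\<close>
  modulo \<open>2 * n + 2\<close>, so the two symmetries together give
  \<open>w x = - w x + 2 * x\<close>.\<close>

lemma equivariant_mult:
  assumes "equivariant n w"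
  shows "w ((int n + 1) * k) = (int n + 1) * k"
proof -
  have "w (- ((int n + 1) * k) + k * (2 * int n + 2)) = w (- ((int n + 1) * k)) + k * (2 * int n + 2)"
    by (rule equivariant_add[OF assms])
  moreover have "- ((int n + 1) * k) + k * (2 * int n + 2) = (int n + 1) * k"
    by (simp add: algebra_simps)
  ultimately have "w ((int n + 1) * k) = - w ((int n + 1) * k) + k * (2 * int n + 2)"
    by (metis equivariant_uminus[OF assms])
  then show ?thesis by (simp add: algebra_simps)
qed

lemma equivariant_skip_cases:
  assumes "equivariant n w" "n > 0"
  obtains y where "w (skip n x) = skip n y"
proof (cases "w (skip n x)" rule: int_skip_cases[OF assms(2)])
  case (1 y)
  then show ?thesis using that by blast
next
  case (2 k)
  then have "w (skip n x) = w ((int n + 1) * k)" using equivariant_mult[OF assms(1)] by simp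
  then have "skip n x = (int n + 1) * k"
    using equivariant_bij[OF assms(1)] by (metis bij_pointE)
  then show ?thesis using not_dvd_skip[OF assms(2), of x] by simp
qed

lemma equivariant_skip_add:
  assumes "equivariant n w" "n > 0"
  shows "w (skip n (x + 2 * int n * q)) = w (skip n x) + (2 * int n + 2) * q"
  using equivariant_add[OF assms(1), of "skip n x" q] skip_period[OF assms(2), of x q]
  by (simp add: mult.commute)

lemma sgen_sgen:
  assumes "n \<ge> 2" "i \<le> n"
  shows "sgen n i (sgen n i x) = x"
proof -
  have n: "n > 0" using assms by simp
  show ?thesis
    using assms by (cases x rule: int_skip_cases[OF n]) (auto simp: sgen_skip sgen_mult swap_swap)
qed

lemma sgen_comp_sgen: "n \<ge> 2 \<Longrightarrow> i \<le> n \<Longrightarrow> sgen n i \<circ> sgen n i = id"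
  by (auto simp: sgen_sgen)

lemma equivariant_sgen:
  assumes "n \<ge> 2" "i \<le> n"
  shows "equivariant n (sgen n i)"
proof -
  have n: "n > 0" using assms by simp
  have "bij (sgen n i)"
    using sgen_comp_sgen[OF assms] by (metis o_bij)
  moreover have "sgen n i (x + (2 * int n + 2)) = sgen n i x + (2 * int n + 2)" for x
  proof (cases x rule: int_skip_cases[OF n])
    case (1 y)
    then have "x + (2 * int n + 2) = skip n (y + 2 * int n * 1)"
      using assms by (subst skip_period) auto
    then show ?thesis using 1 assms sgen_skip swap_period[of n i y 1] skip_period[of n "swap n i y" 1] by simp
  next
    case (2 k)
    then have "x + (2 * int n + 2) = (int n + 1) * (k + 2)" by (simp add: algebra_simps)
    then show ?thesis using 2 assms by (metis sgen_mult)
  qed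
  moreover have "sgen n i (- x) = - sgen n i x" for x
  proof (cases x rule: int_skip_cases[OF n])
    case (1 y)
    then have "- x = skip n (- 1 - y)" using assms by (subst skip_reflect) auto
    then show ?thesis using 1 assms n by (metis sgen_skip swap_reflect skip_reflect)
  next
    case (2 k)
    then show ?thesis using assms sgen_mult[of n i "- k"] sgen_mult[of n i k] by simp
  qed
  ultimately show ?thesis by (simp add: equivariant_def)
qed

section \<open>Type C transpositions and their conjugates\<close>

lemma transposition_sym: "is_transposition n t i j \<Longrightarrow> is_transposition n t j i"
  unfolding is_transposition_def Let_def by blast

lemma cong_int_obtain:
  fixes x i m :: int
  assumes "[x = i] (mod m)"
  obtains q where "x = i + q * m"
  using assms by (metis cong_iff_lin cong_sym mult.commute)

lemma transposition_unique:
  assumes "is_transposition n t i j" "is_transposition n t' i j"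
  shows "t = t'"
proof
  fix x
  let ?m = "2 * int n + 2"
  show "t x = t' x"
  proof (cases "[x = i] (mod ?m) \<or> [x = j] (mod ?m) \<or> [x = - i] (mod ?m) \<or> [x = - j] (mod ?m)")
    case True
    then obtain q where "x = i + q * ?m \<or> x = j + q * ?m \<or> x = - i + q * ?m \<or> x = - j + q * ?m"
      by (meson cong_int_obtain)
    then show ?thesis using assms unfolding is_transposition_def Let_def by metis
  next
    case False
    then show ?thesis using assms unfolding is_transposition_def Let_def by metis
  qed
qed

text \<open>Conjugation only renames the exchanged points. The theorem uses it with the inverse of
  \<open>v\<close> to name the reflection found by the induction.\<close>

lemma transposition_conj:
  assumes "equivariant n v" "is_transposition n t i j"
  shows "is_transposition n (v \<circ> t \<circ> perm_inv v) (v i) (v j)"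
proof -
  let ?m = "2 * int n + 2"
  have b: "bij v" using assms(1) by (rule equivariant_bij)
  have iv: "perm_inv v (v x) = x" "v (perm_inv v x) = x" for x
    using b by (simp_all add: bij_is_inj bij_is_surj surj_f_inv_f)
  have add: "v x + q * ?m = v (x + q * ?m)" "- v x + q * ?m = v (- x + q * ?m)" for x q
    by (simp_all only: equivariant_add[OF assms(1)] equivariant_uminus[OF assms(1)])
  have cong: "[x = v i] (mod ?m)" if c: "[perm_inv v x = i] (mod ?m)" for x i
  proof -
    obtain q where "perm_inv v x = i + q * ?m" using c by (rule cong_int_obtain)
    then have "x = v i + q * ?m" using iv add by metis
    then show ?thesis by (simp add: cong_def)
  qed
  have minus: "- v x = v (- x)" for x using equivariant_uminus[OF assms(1)] by simp
  have swaps: "t (i + q * ?m) = j + q * ?m" "t (j + q * ?m) = i + q * ?m"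
    "t (- i + q * ?m) = - j + q * ?m" "t (- j + q * ?m) = - i + q * ?m" for q
    using assms(2) unfolding is_transposition_def Let_def by blast+
  have fixed: "(v \<circ> t \<circ> perm_inv v) x = x"
    if x: "\<not> [x = v i] (mod ?m)" "\<not> [x = v j] (mod ?m)" "\<not> [x = - v i] (mod ?m)"
      "\<not> [x = - v j] (mod ?m)" for x
  proof -
    have "t (perm_inv v x) = perm_inv v x"
      using assms(2) x cong[of x] unfolding is_transposition_def Let_def minus by blast
    then show ?thesis by (simp add: iv)
  qed
  show ?thesis unfolding is_transposition_def Let_def
    using fixed by (simp only: add o_apply iv swaps) simp
qed

text \<open>One wall determines the whole permutation: negation gives the pair at the wall
  \<open>- p\<close>, and translation gives all other pairs.\<close>

lemma sgen_transposition:
  assumes "n \<ge> 2" "a \<le> n" "wall n a p"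
  shows "is_transposition n (sgen n a) (skip n (p - 1)) (skip n p)"
proof -
  let ?m = "2 * int n + 2"
  have n: "n > 0" using assms by simp
  have add: "skip n x + q * ?m = skip n (x + 2 * int n * q)" for x q
    using skip_period[OF n] by (simp add: mult.commute)
  have minus: "- skip n (p - 1) = skip n (- p)" "- skip n p = skip n (- p - 1)"
    using skip_reflect[OF n, of "p - 1"] skip_reflect[OF n, of p]
      minus_diff_commute[of 1 p] by simp_all
  have w: "wall n a (- p)" using assms(3) wall_uminus by simp
  have s1: "swap n a p = p - 1" "swap n a (- p) = - p - 1" using assms(3) w by (simp_all add: swap_def)
  have s2: "swap n a (p - 1) = p" "swap n a (- p - 1) = - p"
    using s1 swap_swap[OF assms(1), of a p] swap_swap[OF assms(1), of a "- p"] by simp_all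
  have fixed: "sgen n a x = x"
    if x: "\<not> [x = skip n (p - 1)] (mod ?m)" "\<not> [x = skip n p] (mod ?m)"
      "\<not> [x = skip n (- p)] (mod ?m)" "\<not> [x = skip n (- p - 1)] (mod ?m)" for x
  proof (cases x rule: int_skip_cases[OF n])
    case (1 y)
    have c: "[skip n (z + 2 * int n * k) = skip n z] (mod ?m)" for z k
      using skip_period[OF n, of z k] by (simp add: cong_def)
    \<comment> \<open>By \<open>wall_cases\<close>, a position next to a wall is a translate of one
      of the four positions excluded for \<open>x\<close>.\<close>
    have no: "\<not> (wall n a y \<or> wall n a (y + 1))"
    proof
      assume "wall n a y \<or> wall n a (y + 1)"
      then obtain z k where "z \<in> {p, - p, p - 1, - p - 1}" "y = z + 2 * int n * k"
        using wall_cases[OF assms(3)]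
        by (smt (verit) insert_iff)
      then show False using x c 1 by auto
    qed
    then show ?thesis using 1 sgen_skip[OF assms(1,2)] by (simp add: swap_def)
  next
    case (2 k)
    then show ?thesis using assms sgen_mult by simp
  qed
  show ?thesis unfolding is_transposition_def Let_def minus add sgen_skip[OF assms(1,2)] swap_period
    using s1 s2 fixed by auto
qed

lemma sgen_moved:
  assumes "n \<ge> 2" "a \<le> n" "sgen n a x \<noteq> x"
  shows "is_transposition n (sgen n a) x (sgen n a x) \<and> \<not> (int n + 1) dvd x \<and>
    \<not> (int n + 1) dvd sgen n a x \<and> \<not> [x = sgen n a x] (mod 2 * int n + 2)"
proof -
  have n: "n > 0" using assms by simp
  obtain y where x: "x = skip n y"
    using int_skip_cases[OF n, of x] sgen_mult assms by metis
  \<comment> \<open>The two sides of a wall are 1 or 2 apart after \<open>skip\<close>, which is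
    less than the period.\<close>
  have close: "\<not> [skip n (p - 1) = skip n p] (mod 2 * int n + 2)" for p
  proof -
    have "(p - 1) div int n \<le> p div int n" using n by (intro zdiv_mono1) auto
    moreover have "p div int n \<le> (p - 1 + int n * 1) div int n" using n by (intro zdiv_mono1) auto
    moreover have "(p - 1 + int n * 1) div int n = (p - 1) div int n + 1"
      using n by (subst div_mult_self2) auto
    ultimately have "skip n p - skip n (p - 1) \<in> {1, 2}" by (auto simp: skip_def)
    then show ?thesis using assms(1) dvd_small_iff[of "2 * int n + 2" "skip n (p - 1) - skip n p"]
      by (auto simp: cong_iff_dvd_diff)
  qed
  have s: "sgen n a x = skip n (swap n a y)" using x sgen_skip assms by simp
  then have ne: "swap n a y \<noteq> y" using x assms by metis
  show ?thesis
  proof (cases "wall n a y")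
    case True
    then have "sgen n a x = skip n (y - 1)" using s by (simp add: swap_def)
    then show ?thesis using x sgen_transposition[OF assms(1,2) True] transposition_sym not_dvd_skip[OF n]
        close[of y] cong_sym by metis
  next
    case False
    then have w: "wall n a (y + 1)" using ne by (auto simp: swap_def split: if_splits)
    then have "sgen n a x = skip n (y + 1)" using s False by (simp add: swap_def)
    then show ?thesis using x sgen_transposition[OF assms(1,2) w] not_dvd_skip[OF n]
        close[of "y + 1"] by simp
  qed
qed

section \<open>Words in the generators\<close>

lemma word_perm_Nil [simp]: "word_perm n [] = id"
  by (simp add: word_perm_def)

lemma word_perm_Cons [simp]: "word_perm n (a # ws) = sgen n a \<circ> word_perm n ws"
  by (simp add: word_perm_def)

lemma word_perm_append: "word_perm n (vs @ ws) = word_perm n vs \<circ> word_perm n ws"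
  by (induction vs) (auto simp: comp_assoc)

lemma equivariant_word_perm: "n \<ge> 2 \<Longrightarrow> set ws \<subseteq> {0..n} \<Longrightarrow> equivariant n (word_perm n ws)"
  by (induction ws) (auto simp: equivariant_id intro: equivariant_comp equivariant_sgen)

lemma word_perm_rev:
  assumes "n \<ge> 2" "set ws \<subseteq> {0..n}"
  shows "word_perm n (rev ws) = perm_inv (word_perm n ws)"
proof -
  have "word_perm n (rev ws) \<circ> word_perm n ws = id"
    using assms(2)
  proof (induction ws)
    case (Cons a ws)
    have "word_perm n (rev (a # ws)) \<circ> word_perm n (a # ws)
      = word_perm n (rev ws) \<circ> (sgen n a \<circ> sgen n a) \<circ> word_perm n ws"
      by (simp add: word_perm_append comp_assoc)
    also have "\<dots> = word_perm n (rev ws) \<circ> word_perm n ws"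
      using Cons.prems sgen_comp_sgen[OF assms(1), of a] by simp
    also have "\<dots> = id" using Cons.prems by (intro Cons.IH) auto
    finally show ?case .
  qed simp
  then show ?thesis
    using equivariant_bij[OF equivariant_word_perm[OF assms]]
    by (metis bij_is_surj comp_assoc comp_id id_comp surj_iff)
qed

text \<open>\<open>generate\<close> adds inverses of generators, which words do not mention; each
  generator is an involution, so its letter also represents its inverse.\<close>

lemma generate_word:
  assumes "n \<ge> 2" "g \<in> generate (BijGroup UNIV) (sgen n ` I)" "I \<subseteq> {0..n}"
  shows "\<exists>ws. set ws \<subseteq> I \<and> word_perm n ws = g"
  using assms(2)
proof induction
  case one
  show ?case by (rule exI[of _ "[]"]) (auto simp: BijGroup_def)
next
  case (incl h)
  then obtain a where "a \<in> I" "h = sgen n a" by auto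
  then show ?case by (intro exI[of _ "[a]"]) auto
next
  case (inv h)
  then obtain a where a: "a \<in> I" "h = sgen n a" by auto
  then have e: "equivariant n h" using equivariant_sgen assms by auto
  have "inv\<^bsub>BijGroup UNIV\<^esub> h = (\<lambda>x\<in>UNIV. inv_into UNIV h x)"
    using equivariant_bij[OF e] by (intro inv_BijGroup) (simp add: Bij_def)
  also have "\<dots> = h" using a assms sgen_comp_sgen[OF assms(1), of a]
    by (simp add: subset_iff inv_unique_comp restrict_UNIV)
  finally show ?case using a by (intro exI[of _ "[a]"]) auto
next
  case (eng h1 h2)
  then obtain vs ws where w: "set vs \<subseteq> I" "word_perm n vs = h1" "set ws \<subseteq> I" "word_perm n ws = h2"
    by auto
  then have "bij h1" "bij h2"
    using equivariant_bij equivariant_word_perm[OF assms(1)] assms(3) by (metis subset_trans)+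
  then have "h1 \<otimes>\<^bsub>BijGroup UNIV\<^esub> h2 = h1 \<circ> h2"
    by (auto simp: BijGroup_def Bij_def compose_def)
  then show ?case using w by (intro exI[of _ "vs @ ws"]) (auto simp: word_perm_append)
qed

lemma BijGroup_UNIV_mult: "bij g \<Longrightarrow> bij h \<Longrightarrow> g \<otimes>\<^bsub>BijGroup UNIV\<^esub> h = g \<circ> h"
  by (auto simp: BijGroup_def Bij_def compose_def)

lemma word_generate:
  assumes "n \<ge> 2" "set ws \<subseteq> I" "I \<subseteq> {0..n}"
  shows "word_perm n ws \<in> generate (BijGroup UNIV) (sgen n ` I)"
  using assms(2)
proof (induction ws)
  case Nil
  then show ?case using generate.one[of "BijGroup UNIV"] by (simp add: BijGroup_def restrict_UNIV id_def)
next
  case (Cons a ws)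
  then have "set ws \<subseteq> {0..n}" "a \<le> n" using assms(3) by auto
  then have "bij (word_perm n ws)" "bij (sgen n a)"
    using equivariant_bij equivariant_word_perm[OF assms(1)] equivariant_sgen[OF assms(1)] by blast+
  then have eq: "sgen n a \<otimes>\<^bsub>BijGroup UNIV\<^esub> word_perm n ws = word_perm n (a # ws)"
    by (simp only: BijGroup_UNIV_mult word_perm_Cons)
  have "sgen n a \<in> generate (BijGroup UNIV) (sgen n ` I)"
    "word_perm n ws \<in> generate (BijGroup UNIV) (sgen n ` I)"
    using Cons by (auto intro: generate.incl)
  then show ?case using generate.eng eq by metis
qed

lemma affC_iff: "n \<ge> 2 \<Longrightarrow> w \<in> affC n \<longleftrightarrow> (\<exists>ws. is_word n ws w)"
  unfolding affC_def is_word_def using generate_word[of n w "{0..n}"] word_generate[of n _ "{0..n}"]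
  by auto

lemma equivariant_affC: "n \<ge> 2 \<Longrightarrow> w \<in> affC n \<Longrightarrow> equivariant n w"
  unfolding affC_iff is_word_def using equivariant_word_perm by blast

lemma is_word_append: "is_word n vs v \<Longrightarrow> is_word n ws w \<Longrightarrow> is_word n (vs @ ws) (v \<circ> w)"
  unfolding is_word_def by (auto simp: word_perm_append)

lemma is_word_sgen: "a \<le> n \<Longrightarrow> is_word n [a] (sgen n a)"
  unfolding is_word_def by simp

lemma is_word_rev: "n \<ge> 2 \<Longrightarrow> is_word n ws w \<Longrightarrow> is_word n (rev ws) (perm_inv w)"
  unfolding is_word_def using word_perm_rev by auto

lemma sgen_affC: "n \<ge> 2 \<Longrightarrow> a \<le> n \<Longrightarrow> sgen n a \<in> affC n"
  unfolding affC_iff using is_word_sgen by blast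

lemma affC_comp: "n \<ge> 2 \<Longrightarrow> v \<in> affC n \<Longrightarrow> w \<in> affC n \<Longrightarrow> v \<circ> w \<in> affC n"
  unfolding affC_iff using is_word_append by blast

lemma affC_sgen_comp: "n \<ge> 2 \<Longrightarrow> a \<le> n \<Longrightarrow> w \<in> affC n \<Longrightarrow> sgen n a \<circ> w \<in> affC n"
  using affC_comp sgen_affC by blast

lemma affC_inv: "n \<ge> 2 \<Longrightarrow> w \<in> affC n \<Longrightarrow> perm_inv w \<in> affC n"
  unfolding affC_iff using is_word_rev by blast

section \<open>Length, exchange and descents\<close>

lemma cox_length_le: "is_word n ws w \<Longrightarrow> cox_length n w \<le> length ws"
  unfolding cox_length_def by (rule Least_le) auto

lemma reduced_word:
  assumes "n \<ge> 2" "w \<in> affC n"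
  obtains ws where "is_word n ws w" "length ws = cox_length n w"
proof -
  have "\<exists>k ws. is_word n ws w \<and> length ws = k" using assms affC_iff by auto
  from LeastI_ex[OF this] show thesis using that unfolding cox_length_def by blast
qed

lemma is_word_Cons: "a \<le> n \<Longrightarrow> is_word n ws w \<Longrightarrow> is_word n (a # ws) (sgen n a \<circ> w)"
  by (auto simp: is_word_def)

lemma cox_length_sgen_le:
  assumes "n \<ge> 2" "a \<le> n" "w \<in> affC n"
  shows "cox_length n (sgen n a \<circ> w) \<le> Suc (cox_length n w)"
  using reduced_word[OF assms(1,3)] cox_length_le[OF is_word_Cons[OF assms(2)]] by (metis length_Cons)

lemma cox_length_inv:
  assumes "n \<ge> 2" "w \<in> affC n"
  shows "cox_length n (perm_inv w) = cox_length n w"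
proof -
  have le: "cox_length n (perm_inv v) \<le> cox_length n v" if v: "v \<in> affC n" for v
    using reduced_word[OF assms(1) v] cox_length_le[OF is_word_rev[OF assms(1)]] by (metis length_rev)
  show ?thesis using le[OF assms(2)] le[OF affC_inv[OF assms]]
    equivariant_bij[OF equivariant_affC[OF assms]] by (simp add: inv_inv_eq)
qed

text \<open>\<open>v\<close> carries a pair exchanged by \<open>s_b\<close> to a pair exchanged by
  \<open>s_a\<close>, so \<open>s_a\<close> and the conjugate of \<open>s_b\<close> by
  \<open>v\<close> are the same transposition.\<close>

lemma sgen_conj:
  assumes "n \<ge> 2" "a \<le> n" "b \<le> n" "equivariant n v" "wall n a p" "wall n b q"
    and "v (skip n (q - 1)) = skip n (p - 1)" "v (skip n q) = skip n p"
  shows "sgen n a \<circ> v = v \<circ> sgen n b"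
proof -
  have "is_transposition n (v \<circ> sgen n b \<circ> perm_inv v) (skip n (p - 1)) (skip n p)"
    using transposition_conj[OF assms(4) sgen_transposition[OF assms(1,3,6)]] assms(7,8) by simp
  then have "sgen n a = v \<circ> sgen n b \<circ> perm_inv v"
    using sgen_transposition[OF assms(1,2,5)] transposition_unique by blast
  then have "sgen n a \<circ> v = v \<circ> sgen n b \<circ> (perm_inv v \<circ> v)" by (simp add: comp_assoc)
  then show ?thesis using inv_comp_bij(1)[OF equivariant_bij[OF assms(4)]] by simp
qed

text \<open>When the word is applied from right to left, some letter turns the pair at
  \<open>q\<close> from increasing to decreasing. That letter swaps the current images of the pair,
  so by \<open>sgen_conj\<close> it can be pulled through to the right, where it becomes
  \<open>s_b\<close> and cancels.\<close>

lemma exchange: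
  assumes "n \<ge> 2" "b \<le> n" "wall n b q"
    and "set ws \<subseteq> {0..n}" "word_perm n ws (skip n q) < word_perm n ws (skip n (q - 1))"
  shows "\<exists>vs. set vs \<subseteq> {0..n} \<and> length vs < length ws \<and> word_perm n vs = word_perm n ws \<circ> sgen n b"
  using assms(4,5)
proof (induction ws)
  case Nil
  then show ?case using skip_less[of n "q - 1" q] assms(1) by simp
next
  case (Cons a ws)
  let ?v = "word_perm n ws"
  have n: "n > 0" using assms by simp
  have a: "a \<le> n" "set ws \<subseteq> {0..n}" using Cons by auto
  have v: "equivariant n ?v" using equivariant_word_perm[OF assms(1) a(2)] .
  show ?case
  proof (cases "?v (skip n q) < ?v (skip n (q - 1))")
    case True
    then obtain vs where "set vs \<subseteq> {0..n}" "length vs < length ws" "word_perm n vs = ?v \<circ> sgen n b"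
      using Cons.IH[OF a(2) True] by blast
    then show ?thesis using a by (intro exI[of _ "a # vs"]) (auto simp: comp_assoc)
  next
    case False
    obtain x y where xy: "?v (skip n (q - 1)) = skip n x" "?v (skip n q) = skip n y"
      using equivariant_skip_cases[OF v n] by metis
    have "skip n (q - 1) \<noteq> skip n q" using n by (simp add: skip_eq_iff)
    then have "?v (skip n (q - 1)) \<noteq> ?v (skip n q)"
      using equivariant_bij[OF v] by (metis bij_pointE)
    then have lt: "x < y" using False xy n by (simp add: skip_less_iff skip_eq_iff)
    \<comment> \<open>A swap moves each position by at most one, so the order can be reversed only
      for neighbours on the two sides of a wall.\<close>
    have "swap n a y < swap n a x"
      using Cons.prems xy a(1) n by (simp add: sgen_skip[OF assms(1)] skip_less_iff)
    then have y: "x = y - 1" "wall n a y"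
      using lt by (auto simp: swap_def split: if_splits)
    have "sgen n a \<circ> ?v = ?v \<circ> sgen n b"
      using sgen_conj[OF assms(1) a(1) assms(2) v y(2) assms(3)] xy y(1) by simp
    then have "word_perm n (a # ws) \<circ> sgen n b = ?v"
      using sgen_comp_sgen[OF assms(1,2)] by (simp add: comp_assoc)
    then show ?thesis using a(2) by (intro exI[of _ ws] conjI) (simp_all only: length_Cons lessI)
  qed
qed

lemma cox_length_descent_right:
  assumes "n \<ge> 2" "b \<le> n" "wall n b q" "w \<in> affC n" "w (skip n q) < w (skip n (q - 1))"
  shows "cox_length n (w \<circ> sgen n b) < cox_length n w"
proof -
  obtain ws where "is_word n ws w" "length ws = cox_length n w"
    using reduced_word[OF assms(1,4)] .
  moreover from this obtain vs where "is_word n vs (w \<circ> sgen n b)" "length vs < length ws"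
    using exchange[OF assms(1-3), of ws] assms(5) unfolding is_word_def by auto
  ultimately show ?thesis using cox_length_le by fastforce
qed

lemma cox_length_descent_left:
  assumes "n \<ge> 2" "a \<le> n" "wall n a p" "w \<in> affC n"
    and "perm_inv w (skip n p) < perm_inv w (skip n (p - 1))"
  shows "cox_length n (sgen n a \<circ> w) < cox_length n w"
proof -
  have "perm_inv (sgen n a \<circ> w) = perm_inv w \<circ> perm_inv (sgen n a)"
    using assms by (intro o_inv_distrib equivariant_bij[of n]) (auto intro: equivariant_sgen equivariant_affC)
  also have "perm_inv (sgen n a) = sgen n a"
    using sgen_comp_sgen[OF assms(1,2)] by (simp add: inv_unique_comp)
  finally have "perm_inv (sgen n a \<circ> w) = perm_inv w \<circ> sgen n a" .
  then show ?thesis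
    using cox_length_descent_right[OF assms(1-3) affC_inv[OF assms(1,4)] assms(5)]
      cox_length_inv[OF assms(1,4)] cox_length_inv[OF assms(1) affC_sgen_comp[OF assms(1,2,4)]] by simp
qed

section \<open>Grassmannian elements\<close>

lemma affC0_affC: "w \<in> affC0 n \<Longrightarrow> w \<in> affC n"
  by (simp add: affC0_def)

text \<open>A decrease at such a wall would make \<open>w s_b\<close> a shorter element of the same
  coset.\<close>

lemma affC0_ascent:
  assumes "n \<ge> 2" "w \<in> affC0 n" "1 \<le> b" "b \<le> n" "wall n b q"
  shows "w (skip n (q - 1)) < w (skip n q)"
proof (rule ccontr)
  have n: "n > 0" using assms by simp
  have e: "equivariant n w" using assms affC0_affC equivariant_affC by blast
  have "skip n (q - 1) \<noteq> skip n q" using n by (simp add: skip_eq_iff)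
  then have "w (skip n (q - 1)) \<noteq> w (skip n q)" using equivariant_bij[OF e] by (metis bij_pointE)
  moreover assume "\<not> ?thesis"
  ultimately have "w (skip n q) < w (skip n (q - 1))" by simp
  then have "cox_length n (w \<circ> sgen n b) < cox_length n w"
    using cox_length_descent_right assms affC0_affC by blast
  moreover have "w \<circ> sgen n b \<in> w <#\<^bsub>BijGroup UNIV\<^esub> finC n"
  proof -
    have "sgen n b \<in> finC n" unfolding finC_def using assms by (auto intro: generate.incl)
    moreover have "w \<otimes>\<^bsub>BijGroup UNIV\<^esub> sgen n b = w \<circ> sgen n b"
      by (rule BijGroup_UNIV_mult) (use e equivariant_bij equivariant_sgen assms in blast)+
    ultimately show ?thesis unfolding l_coset_def by force
  qed
  ultimately show False using assms(2) unfolding affC0_def by force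
qed

text \<open>For \<open>h\<close> in the finite group, the length of \<open>u\<close> is at most that
  of \<open>u h\<close>, hence at most one more than that of \<open>s_a u h\<close>. Since
  \<open>s_a u\<close> is exactly one shorter than \<open>u\<close>, it is again minimal.\<close>

lemma affC0_descent:
  assumes "n \<ge> 2" "a \<le> n" "u \<in> affC0 n" "cox_length n (sgen n a \<circ> u) < cox_length n u"
  shows "sgen n a \<circ> u \<in> affC0 n" "cox_length n u = Suc (cox_length n (sgen n a \<circ> u))"
proof -
  have u: "u \<in> affC n" using assms affC0_affC by blast
  have s: "sgen n a \<circ> (sgen n a \<circ> v) = v" for v
    using sgen_comp_sgen[OF assms(1,2)] by (simp add: comp_assoc[symmetric])
  show len: "cox_length n u = Suc (cox_length n (sgen n a \<circ> u))"
    using cox_length_sgen_le[OF assms(1,2) affC_sgen_comp[OF assms(1,2) u]] assms(4) by (simp add: s)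
  show "sgen n a \<circ> u \<in> affC0 n" unfolding affC0_def
  proof (safe intro!: affC_sgen_comp[OF assms(1,2) u])
    fix v
    assume "v \<in> (sgen n a \<circ> u) <#\<^bsub>BijGroup UNIV\<^esub> finC n"
    then obtain h where h: "h \<in> finC n" "v = (sgen n a \<circ> u) \<otimes>\<^bsub>BijGroup UNIV\<^esub> h"
      unfolding l_coset_def by auto
    obtain ws where ws: "set ws \<subseteq> {1..n}" "word_perm n ws = h"
      using generate_word[OF assms(1)] h(1) unfolding finC_def by fastforce
    then have hC: "h \<in> affC n" unfolding affC_iff[OF assms(1)] is_word_def by force
    have b: "bij h" "bij u" "bij (sgen n a \<circ> u)"
      using equivariant_bij[OF equivariant_affC[OF assms(1)]] hC u affC_sgen_comp[OF assms(1,2) u] by blast+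
    then have v: "v = sgen n a \<circ> (u \<circ> h)"
      using h(2) BijGroup_UNIV_mult[of "sgen n a \<circ> u" h] by (simp add: comp_assoc)
    have "u \<circ> h \<in> u <#\<^bsub>BijGroup UNIV\<^esub> finC n"
      unfolding l_coset_def using h(1) BijGroup_UNIV_mult[OF b(2,1)] by force
    then have "cox_length n u \<le> cox_length n (u \<circ> h)" using assms(3) unfolding affC0_def by blast
    also have "u \<circ> h = sgen n a \<circ> v" by (simp add: v s)
    also have "cox_length n (sgen n a \<circ> v) \<le> Suc (cox_length n v)"
      using assms(1,2) v affC_sgen_comp affC_comp u hC by (intro cox_length_sgen_le) auto
    finally show "cox_length n (sgen n a \<circ> u) \<le> cox_length n v" using len by simp
  qed
qed

lemma skip_neg_iff: "n > 0 \<Longrightarrow> skip n x < 0 \<longleftrightarrow> x < 0"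
  using skip_less_iff[of n x 0] not_dvd_skip[of n x] by (cases "skip n x = 0") (auto simp: skip_def)

lemma mem_image_neg_iff:
  assumes "equivariant n w" "n > 0"
  shows "w (skip n x) \<in> w ` {..<0} \<longleftrightarrow> x < 0"
  using equivariant_bij[OF assms(1)] skip_neg_iff[OF assms(2)] by (auto simp: bij_def inj_image_mem_iff)

text \<open>In each class modulo \<open>2 * n\<close>, the window contains the one \<open>x\<close>
  with \<open>x\<close> nonnegative and \<open>x - 2 * n\<close> negative. Both signs can be read
  off from the image of the negative integers.\<close>

lemma window_values:
  assumes "equivariant n w" "n > 0"
  shows "(\<lambda>k. w (skip n (int k))) ` {0..<2 * n} =
    {skip n y | y. skip n y \<notin> w ` {..<0} \<and> skip n (y - 2 * int n) \<in> w ` {..<0}}" (is "?L = ?R")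
proof (intro Set.set_eqI iffI)
  have shift: "skip n (y - 2 * int n) = w (skip n (x - 2 * int n))" if "w (skip n x) = skip n y" for x y
    using that equivariant_skip_add[OF assms, of x "- 1"] skip_period[OF assms(2), of y "- 1"] by simp
  {
    fix z assume "z \<in> ?L"
    then obtain k where k: "k < 2 * n" "z = w (skip n (int k))" by auto
    then obtain y where y: "w (skip n (int k)) = skip n y" using equivariant_skip_cases[OF assms] by blast
    then have "skip n y \<notin> w ` {..<0}" using mem_image_neg_iff[OF assms, of "int k"] by simp
    moreover have "skip n (y - 2 * int n) \<in> w ` {..<0}"
      using mem_image_neg_iff[OF assms, of "int k - 2 * int n"] shift[OF y] k by simp
    ultimately show "z \<in> ?R" using k y by auto
  next
    fix z assume "z \<in> ?R"
    then obtain y where y: "z = skip n y" "skip n y \<notin> w ` {..<0}" "skip n (y - 2 * int n) \<in> w ` {..<0}"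
      by blast
    obtain x where "perm_inv w (skip n y) = skip n x"
      using equivariant_skip_cases[OF equivariant_inv[OF assms(1)] assms(2)] by blast
    then have x: "w (skip n x) = skip n y"
      using equivariant_bij[OF assms(1)] by (metis bij_inv_eq_iff)
    have "\<not> x < 0" using mem_image_neg_iff[OF assms, of x] x y by simp
    moreover have "x - 2 * int n < 0"
      using mem_image_neg_iff[OF assms, of "x - 2 * int n"] shift[OF x] y by simp
    ultimately show "z \<in> ?L" using x y by (intro image_eqI[of _ _ "nat x"]) auto
  }
qed

text \<open>An affine Grassmannian element is increasing on the fundamental window, so the set of its
  values there determines it.\<close>

lemma affC0_eqI:
  assumes "n \<ge> 2" "w \<in> affC0 n" "u \<in> affC0 n"
    and "\<And>x. skip n x \<in> w ` {..<0} \<longleftrightarrow> skip n x \<in> u ` {..<0}"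
  shows "w = u"
proof
  have n: "n > 0" using assms by simp
  have e: "equivariant n w" "equivariant n u" using assms affC0_affC equivariant_affC by blast+
  define L where "L v = map (\<lambda>k. v (skip n (int k))) [0..<2 * n]" for v :: "int \<Rightarrow> int"
  have sorted: "sorted_wrt (<) (L v)" if v: "v \<in> affC0 n" for v
  proof -
    have "v (skip n (int k)) < v (skip n (int (Suc k)))" if "Suc k < 2 * n" for k
    proof -
      \<comment> \<open>The generator with a wall at \<open>k + 1\<close>. It is never
        \<open>s_0\<close>, as \<open>k + 1\<close> stays strictly between 0 and
        \<open>2 * n\<close>; so every step inside the window is an ascent.\<close>
      define b where "b = (if Suc k \<le> n then Suc k else 2 * n - Suc k)"
      have "wall n b (int (Suc k))" using that unfolding wall_def b_def by auto
      moreover have "1 \<le> b" "b \<le> n" using that by (auto simp: b_def)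
      ultimately have "v (skip n (int (Suc k) - 1)) < v (skip n (int (Suc k)))"
        using affC0_ascent[OF assms(1) v] by blast
      then show ?thesis by simp
    qed
    then show ?thesis unfolding L_def by (subst sorted_wrt_iff_nth_Suc_transp) (auto simp: transp_def)
  qed
  have "set (L w) = set (L u)"
    using window_values[OF e(1) n] window_values[OF e(2) n] assms(4) by (simp add: L_def)
  then have "L w = L u" using sorted assms by (intro strict_sorted_equal) auto
  then have window: "w (skip n (int k)) = u (skip n (int k))" if "k < 2 * n" for k
    using that by (auto simp: L_def)
  fix z
  show "w z = u z"
  proof (cases z rule: int_skip_cases[OF n])
    case (1 x)
    obtain q r where x: "x = 2 * int n * q + r" "0 \<le> r" "r < 2 * int n"
      using div_mod_cases[of "2 * int n" x] n by auto
    then have "w (skip n r) = u (skip n r)" using window[of "nat r"] by simp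
    then show ?thesis
      using 1 x equivariant_skip_add[OF e(1) n, of r q] equivariant_skip_add[OF e(2) n, of r q]
      by (simp add: add.commute)
  next
    case (2 k)
    then show ?thesis using e equivariant_mult by metis
  qed
qed

section \<open>Diagrams and their diagonals\<close>

text \<open>A profile counts the boxes on each diagonal; the box \<open>(r, c)\<close> is the one numbered
  \<open>min r c\<close> on its diagonal.\<close>

definition profile :: "(int \<Rightarrow> int) \<Rightarrow> bool" where
  "profile f \<longleftrightarrow> finite {x. f x \<noteq> 0} \<and> (\<forall>x. 0 \<le> f x) \<and>
     (\<forall>x. f x - f (x + 1) + (if x < 0 then 1 else 0) \<in> {0, 1})"

text \<open>The edge sequence (Maya diagram) of the partition: beads are the vertical unit steps of
  the boundary, gaps the horizontal ones. The correction for \<open>x < 0\<close> makes the empty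
  diagram have its beads at the negative integers.\<close>

definition bead :: "(int \<Rightarrow> int) \<Rightarrow> int \<Rightarrow> bool" where
  "bead f x \<longleftrightarrow> f x - f (x + 1) + (if x < 0 then 1 else 0) = 1"

definition diagram :: "(int \<Rightarrow> int) \<Rightarrow> box set" where
  "diagram f = {(r, c). 1 \<le> r \<and> 1 \<le> c \<and> int (min r c) \<le> f (int c - int r)}"

text \<open>A new box on diagonal \<open>x\<close> moves a bead from \<open>x - 1\<close> to
  \<open>x\<close>.\<close>

definition can_add :: "(int \<Rightarrow> int) \<Rightarrow> int \<Rightarrow> bool" where
  "can_add f x \<longleftrightarrow> bead f (x - 1) \<and> \<not> bead f x"

definition can_remove :: "(int \<Rightarrow> int) \<Rightarrow> int \<Rightarrow> bool" where
  "can_remove f x \<longleftrightarrow> bead f x \<and> \<not> bead f (x - 1)"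

text \<open>Boxes on all diagonals in \<open>X\<close> are added at once. This is consistent for
  every \<open>X\<close>, because two neighbouring diagonals are never both addable.\<close>

definition raise :: "(int \<Rightarrow> bool) \<Rightarrow> (int \<Rightarrow> int) \<Rightarrow> int \<Rightarrow> int" where
  "raise X f x = (if X x \<and> can_add f x then f x + 1 else f x)"

definition lower :: "(int \<Rightarrow> bool) \<Rightarrow> (int \<Rightarrow> int) \<Rightarrow> int \<Rightarrow> int" where
  "lower X f x = (if X x \<and> can_remove f x then f x - 1 else f x)"

section \<open>Diagrams as finite down-closed sets of boxes\<close>

lemma is_diagram_pos: "is_diagram D \<Longrightarrow> (r, c) \<in> D \<Longrightarrow> 1 \<le> r \<and> 1 \<le> c"
  unfolding is_diagram_def dg_def by auto

lemma is_diagram_down: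
  assumes "is_diagram D" "(r, c) \<in> D" "1 \<le> r'" "r' \<le> r" "1 \<le> c'" "c' \<le> c"
  shows "(r', c') \<in> D"
proof -
  obtain \<mu> where \<mu>: "is_partition \<mu>" "dg \<mu> = D" using assms(1) unfolding is_diagram_def by blast
  have r: "1 \<le> r" "r \<le> length \<mu>" "c \<le> \<mu> ! (r - 1)" using \<mu>(2) assms(2) unfolding dg_def by auto
  have "\<mu> ! (r - 1) \<le> \<mu> ! (r' - 1)"
  proof (cases "r' = r")
    case False
    then have "r' - 1 < r - 1" "r - 1 < length \<mu>" using assms(3,4) r by auto
    then show ?thesis using \<mu>(1) sorted_wrt_nth_less[of "(\<ge>)" \<mu>] unfolding is_partition_def by blast
  qed simp
  then have "(r', c') \<in> dg \<mu>" unfolding dg_def using r assms(3-) by auto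
  then show ?thesis using \<mu> by simp
qed

lemma nat_down_set:
  fixes A :: "nat set"
  assumes "finite A" "\<And>k. k \<in> A \<Longrightarrow> 1 \<le> k" "\<And>k. Suc k \<in> A \<Longrightarrow> 1 \<le> k \<Longrightarrow> k \<in> A"
  shows "A = {1..card A}"
proof -
  have down: "j \<in> A" if "k \<in> A" "1 \<le> j" "j \<le> k" for j k
    using that(3,1)
    by (induction rule: dec_induct) (use assms(3) that(2) in auto)
  show ?thesis
  proof (cases "A = {}")
    case False
    then have "A = {1..Max A}"
      using assms(1,2) down[OF Max_in[OF assms(1) False]] by (intro equalityI subsetI) auto
    moreover from this have "card A = Max A" by (metis card_atLeastAtMost diff_Suc_1)
    ultimately show ?thesis by simp
  qed simp
qed

lemma is_diagramI:
  assumes "finite D" "\<And>r c. (r, c) \<in> D \<Longrightarrow> 1 \<le> r \<and> 1 \<le> c"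
    and "\<And>r c. (Suc r, c) \<in> D \<Longrightarrow> 1 \<le> r \<Longrightarrow> (r, c) \<in> D"
    and "\<And>r c. (r, Suc c) \<in> D \<Longrightarrow> 1 \<le> c \<Longrightarrow> (r, c) \<in> D"
  shows "is_diagram D"
proof -
  define row where "row r = {c. (r, c) \<in> D}" for r
  define rows where "rows = {r. (r, 1) \<in> D}"
  define \<mu> where "\<mu> = map (\<lambda>r. card (row (Suc r))) [0..<card rows]"
  have fin: "finite (row r)" for r
    by (rule finite_subset[OF _ finite_imageI[OF assms(1), of snd]]) (force simp: row_def)
  have "finite rows"
    by (rule finite_subset[OF _ finite_imageI[OF assms(1), of fst]]) (force simp: rows_def)
  then have rows: "rows = {1..card rows}"
    by (rule nat_down_set) (unfold rows_def mem_Collect_eq, use assms(2) in blast, use assms(3) in blast)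
  have row: "row r = {1..card (row r)}" for r
    by (rule nat_down_set[OF fin]) (unfold row_def mem_Collect_eq, use assms(2) in blast, use assms(4) in blast)
  have iff: "(r, c) \<in> D \<longleftrightarrow> 1 \<le> c \<and> c \<le> card (row r)" for r c
    using row[of r] unfolding row_def by auto
  have first: "(r, 1) \<in> D" if "(r, c) \<in> D" for r c
    using that iff[of r c] iff[of r 1] by auto
  have in_rows: "1 \<le> r \<and> r \<le> card rows \<longleftrightarrow> (r, 1) \<in> D" for r
    using rows unfolding rows_def by auto
  have "dg \<mu> = D"
  proof (intro Set.set_eqI, clarify)
    fix r c
    have "(r, c) \<in> dg \<mu> \<longleftrightarrow> 1 \<le> r \<and> r \<le> card rows \<and> 1 \<le> c \<and> c \<le> card (row r)"
      unfolding dg_def \<mu>_def by auto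
    then show "(r, c) \<in> dg \<mu> \<longleftrightarrow> (r, c) \<in> D" using in_rows[of r] iff[of r c] first[of r c] by auto
  qed
  moreover have "is_partition \<mu>"
  proof -
    have "card (row (Suc (Suc r))) \<le> card (row (Suc r))" for r
      by (rule card_mono[OF fin]) (use assms(3)[of "Suc r"] in \<open>auto simp: row_def\<close>)
    then have "sorted_wrt (\<ge>) \<mu>"
      by (subst sorted_wrt_iff_nth_Suc_transp) (auto simp: \<mu>_def transp_def)
    moreover have "card (row (Suc r)) \<noteq> 0" if "r < card rows" for r
      using in_rows[of "Suc r"] iff[of "Suc r" 1] that by auto
    ultimately show ?thesis unfolding is_partition_def \<mu>_def by fastforce
  qed
  ultimately show ?thesis unfolding is_diagram_def by blast
qed

lemma partition_eqI:
  assumes "is_partition \<mu>" "is_partition \<nu>" "dg \<mu> = dg \<nu>"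
  shows "\<mu> = \<nu>"
proof (rule nth_equalityI)
  have pos: "r < length \<mu> \<longleftrightarrow> (Suc r, 1) \<in> dg \<mu>" if "is_partition \<mu>" for r \<mu>
  proof -
    have "1 \<le> \<mu> ! r" if "r < length \<mu>"
      using \<open>is_partition \<mu>\<close> nth_mem[OF that] unfolding is_partition_def
      by (metis One_nat_def Suc_leI gr0I)
    then show ?thesis by (auto simp: dg_def)
  qed
  have "r < length \<mu> \<longleftrightarrow> r < length \<nu>" for r
    unfolding pos[OF assms(1)] pos[OF assms(2)] assms(3) ..
  then show len: "length \<mu> = length \<nu>" by (metis linorder_neqE_nat less_irrefl)
  fix r
  assume r: "r < length \<mu>"
  have "{1..\<mu> ! r} = {c. (Suc r, c) \<in> dg \<mu>}" "{1..\<nu> ! r} = {c. (Suc r, c) \<in> dg \<nu>}"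
    using r len unfolding dg_def by auto
  then have "card {1..\<mu> ! r} = card {1..\<nu> ! r}" using assms(3) by simp
  then show "\<mu> ! r = \<nu> ! r" by simp
qed

lemma partition_of_diagram:
  assumes "is_diagram D"
  shows "is_partition (partition_of D)" "dg (partition_of D) = D"
proof -
  have "\<exists>!\<mu>. is_partition \<mu> \<and> dg \<mu> = D"
    using assms partition_eqI unfolding is_diagram_def by blast
  from theI'[OF this] show "is_partition (partition_of D)" "dg (partition_of D) = D"
    unfolding partition_of_def by auto
qed

section \<open>Profiles and their beads\<close>

lemma profile_step:
  assumes "profile f"
  shows "f x - f (x + 1) + (if x < 0 then 1 else 0) = (if bead f x then 1 else 0)"
proof -
  have "f x - f (x + 1) + (if x < 0 then 1 else 0) \<in> {0, 1}" using assms unfolding profile_def by blast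
  then show ?thesis by (auto simp: bead_def)
qed

lemma profile_pos: "profile f \<Longrightarrow> 0 \<le> f x"
  by (simp add: profile_def)

lemma profile_finite: "profile f \<Longrightarrow> finite {x. f x \<noteq> 0}"
  by (simp add: profile_def)

lemma profileI:
  assumes "finite {x. f x \<noteq> 0}" "\<And>x. 0 \<le> f x"
    and "\<And>x. f x - f (x + 1) + (if x < 0 then 1 else 0) = (if B x then 1 else 0)"
  shows "profile f \<and> (\<forall>x. bead f x \<longleftrightarrow> B x)"
  using assms unfolding profile_def bead_def by (auto split: if_splits)

lemma profile_zero: "profile (\<lambda>_. 0)" "bead (\<lambda>_. 0) x \<longleftrightarrow> x < 0"
  by (auto simp: profile_def bead_def)

lemma diagram_zero: "diagram (\<lambda>_. 0) = {}"
  by (auto simp: diagram_def min_def)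

lemma is_diagram_diagram:
  assumes "profile f"
  shows "is_diagram (diagram f)"
proof (rule is_diagramI)
  \<comment> \<open>A box is determined by its content and its number on the diagonal, and both
    range over finite sets.\<close>
  let ?g = "\<lambda>b :: box. (int (snd b) - int (fst b), int (min (fst b) (snd b)))"
  have "inj_on ?g (diagram f)" by (auto simp: inj_on_def min_def split: if_splits)
  moreover have "?g ` diagram f \<subseteq> (SIGMA x:{x. f x \<noteq> 0}. {1..f x})"
    by (auto simp: diagram_def min_def split: if_splits)
  moreover have "finite (SIGMA x:{x. f x \<noteq> 0}. {1..f x})"
    using profile_finite[OF assms] by (intro finite_SigmaI) auto
  ultimately show "finite (diagram f)" by (rule inj_on_finite)
next
  fix r c assume *: "(Suc r, c) \<in> diagram f" "1 \<le> r"
  have "int c - int (Suc r) + 1 = int c - int r" by simp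
  then show "(r, c) \<in> diagram f"
    using * profile_step[OF assms, of "int c - int (Suc r)"]
    by (auto simp: diagram_def min_def split: if_splits)
next
  fix r c assume *: "(r, Suc c) \<in> diagram f" "1 \<le> c"
  have "f (1 + int c - int r) = f ((int c - int r) + 1)" by (simp add: algebra_simps)
  then show "(r, c) \<in> diagram f"
    using * profile_step[OF assms, of "int c - int r"]
    by (auto simp: diagram_def min_def split: if_splits)
qed (auto simp: diagram_def)

text \<open>Where \<open>f\<close> vanishes at \<open>x\<close> and at both neighbours, the beads
  look like those of the empty diagram, which has its only corner at 0. So the support can grow only
  by 0 and by neighbours of the old support.\<close>

lemma profile_change:
  assumes "profile f" "\<And>x. g x \<noteq> f x \<Longrightarrow> can_add f x \<or> can_remove f x"
  shows "finite {x. g x \<noteq> 0}"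
proof -
  let ?S = "{x. f x \<noteq> 0}"
  have "x = 0 \<or> f x \<noteq> 0 \<or> f (x + 1) \<noteq> 0 \<or> f (x - 1) \<noteq> 0" if "g x \<noteq> 0" for x
  proof (cases "g x = f x")
    case False
    then show ?thesis
      using assms(2)[OF False] profile_step[OF assms(1), of x] profile_step[OF assms(1), of "x - 1"]
      unfolding can_add_def can_remove_def by (auto split: if_splits)
  qed (use that in auto)
  then have "{x. g x \<noteq> 0} \<subseteq> {0} \<union> ?S \<union> (\<lambda>x. x - 1) ` ?S \<union> (\<lambda>x. x + 1) ` ?S"
    by (auto simp: image_iff) (metis add_diff_cancel diff_add_cancel)
  then show ?thesis
    using profile_finite[OF assms(1)] by (elim finite_subset) auto
qed

lemma raise_profile:
  assumes "profile f"
  shows "profile (raise X f) \<and> (\<forall>x. bead (raise X f) x \<longleftrightarrow>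
    bead f x \<and> \<not> (X (x + 1) \<and> can_add f (x + 1)) \<or> X x \<and> can_add f x)"
proof (rule profileI)
  show "finite {x. raise X f x \<noteq> 0}"
    by (rule profile_change[OF assms]) (auto simp: raise_def split: if_splits)
  show "0 \<le> raise X f x" for x
    using profile_pos[OF assms, of x] by (simp add: raise_def)
  show "raise X f x - raise X f (x + 1) + (if x < 0 then 1 else 0) =
    (if bead f x \<and> \<not> (X (x + 1) \<and> can_add f (x + 1)) \<or> X x \<and> can_add f x then 1 else 0)" for x
    using profile_step[OF assms, of x] by (auto simp: raise_def can_add_def)
qed

lemma lower_profile:
  assumes "profile f"
  shows "profile (lower X f) \<and> (\<forall>x. bead (lower X f) x \<longleftrightarrow>
    bead f x \<and> \<not> (X x \<and> can_remove f x) \<or> X (x + 1) \<and> can_remove f (x + 1))"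
proof (rule profileI)
  show "finite {x. lower X f x \<noteq> 0}"
    by (rule profile_change[OF assms]) (auto simp: lower_def split: if_splits)
  show "0 \<le> lower X f x" for x
    using profile_pos[OF assms, of x] profile_pos[OF assms, of "x + 1"] profile_pos[OF assms, of "x - 1"]
      profile_step[OF assms, of x] profile_step[OF assms, of "x - 1"]
    by (auto simp: lower_def can_remove_def split: if_splits)
  show "lower X f x - lower X f (x + 1) + (if x < 0 then 1 else 0) =
    (if bead f x \<and> \<not> (X x \<and> can_remove f x) \<or> X (x + 1) \<and> can_remove f (x + 1) then 1 else 0)" for x
    using profile_step[OF assms, of x] by (auto simp: lower_def can_remove_def)
qed

text \<open>Equal beads make \<open>f - g\<close> constant, and finite supports force the constant
  to be 0.\<close>

lemma profile_eqI:
  assumes "profile f" "profile g" "\<And>x. bead f x \<longleftrightarrow> bead g x"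
  shows "f = g"
proof
  fix x
  have const: "f y - g y = f (y + 1) - g (y + 1)" for y
    using profile_step[OF assms(1), of y] profile_step[OF assms(2), of y] assms(3)[of y]
    by (auto split: if_splits)
  have shift: "f (x + int k) - g (x + int k) = f x - g x" for k
  proof (induction k)
    case (Suc k)
    then show ?case using const[of "x + int k"] by (simp add: algebra_simps)
  qed simp
  have "finite ({x. f x \<noteq> 0} \<union> {x. g x \<noteq> 0})"
    using profile_finite assms by auto
  moreover have "infinite (range (\<lambda>k. x + int k))"
    by (subst finite_image_iff) (auto simp: inj_on_def)
  ultimately have "\<not> range (\<lambda>k. x + int k) \<subseteq> {x. f x \<noteq> 0} \<union> {x. g x \<noteq> 0}"
    using finite_subset by blast
  then obtain k where "f (x + int k) = 0" "g (x + int k) = 0" by blast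
  then show "f x = g x" using shift[of k] by simp
qed

lemma diagram_mono:
  assumes "profile f" "profile g"
  shows "diagram f \<subseteq> diagram g \<longleftrightarrow> (\<forall>x. f x \<le> g x)"
proof (intro iffI allI)
  fix x
  assume sub: "diagram f \<subseteq> diagram g"
  show "f x \<le> g x"
  proof (cases "f x = 0")
    case True
    then show ?thesis using profile_pos[OF assms(2)] by simp
  next
    case False
    define r c where "r = nat (if x \<ge> 0 then f x else f x - x)" and "c = nat (if x \<ge> 0 then f x + x else f x)"
    have "int c - int r = x" "int (min r c) = f x" "1 \<le> r" "1 \<le> c"
      using False profile_pos[OF assms(1), of x] by (auto simp: r_def c_def min_def)
    then have "(r, c) \<in> diagram f" "(r, c) \<in> diagram g \<Longrightarrow> f x \<le> g x" by (auto simp: diagram_def)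
    then show ?thesis using sub by blast
  qed
next
  assume le: "\<forall>x. f x \<le> g x"
  show "diagram f \<subseteq> diagram g"
  proof clarify
    fix r c
    assume "(r, c) \<in> diagram f"
    then show "(r, c) \<in> diagram g"
      using le[rule_format, of "int c - int r"] by (auto simp: diagram_def)
  qed
qed

section \<open>Corners, read off from the beads\<close>

lemma mem_diagram: "(r, c) \<in> diagram f \<longleftrightarrow> 1 \<le> r \<and> 1 \<le> c \<and> int (min r c) \<le> f (int c - int r)"
  by (simp add: diagram_def)

text \<open>The new box requires its left and lower neighbours, which bounds the two adjacent
  diagonals from below; the bead condition leaves only one possibility. Conversely, the insertion is
  \<open>raise\<close> on a single diagonal.\<close>

lemma is_diagram_insert:
  assumes "profile f"
  shows "(r, c) \<notin> diagram f \<and> is_diagram (insert (r, c) (diagram f)) \<longleftrightarrow>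
    1 \<le> r \<and> 1 \<le> c \<and> can_add f (int c - int r) \<and> int (min r c) = f (int c - int r) + 1" (is "?L \<longleftrightarrow> ?R")
proof
  define x where "x = int c - int r"
  assume L: ?L
  then have pos: "1 \<le> r" "1 \<le> c" using is_diagram_pos[of _ r c] by blast+
  have out: "f x < int (min r c)" using L pos by (simp add: mem_diagram x_def)
  \<comment> \<open>In the first column there is no left neighbour, and the bound is just
    nonnegativity of the profile.\<close>
  have left: "int (min r (c - 1)) \<le> f (x - 1)"
  proof (cases "c = 1")
    case False
    have "(r, c - 1) \<in> insert (r, c) (diagram f)"
      by (rule is_diagram_down[OF conjunct2[OF L], of r c]) (use pos False in auto)
    then have "(r, c - 1) \<in> diagram f" using pos by auto
    moreover have "int (c - 1) - int r = x - 1" using pos by (simp add: of_nat_diff x_def)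
    ultimately show ?thesis by (simp add: mem_diagram)
  qed (use profile_pos[OF assms, of "x - 1"] in simp)
  have below: "int (min (r - 1) c) \<le> f (x + 1)"
  proof (cases "r = 1")
    case False
    have "(r - 1, c) \<in> insert (r, c) (diagram f)"
      by (rule is_diagram_down[OF conjunct2[OF L], of r c]) (use pos False in auto)
    then have "(r - 1, c) \<in> diagram f" using pos by auto
    moreover have "int c - int (r - 1) = x + 1" using pos by (simp add: of_nat_diff x_def)
    ultimately show ?thesis by (simp add: mem_diagram)
  qed (use profile_pos[OF assms, of "x + 1"] in simp)
  have step: "f x - f (x + 1) + (if x < 0 then 1 else 0) = (if bead f x then 1 else 0)"
    "f (x - 1) - f x + (if x - 1 < 0 then 1 else 0) = (if bead f (x - 1) then 1 else 0)"
    using profile_step[OF assms, of x] profile_step[OF assms, of "x - 1"] by simp_all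
  have "can_add f x \<and> int (min r c) = f x + 1"
  proof (cases "r \<le> c")
    case True
    then have "int r - 1 \<le> f (x + 1)" "f x < int r" "x \<ge> 0"
      "int r \<le> f (x - 1) + (if x - 1 < 0 then 1 else 0)"
      using below out left pos by (auto simp: x_def min_def of_nat_diff split: if_splits)
    then show ?thesis using step True unfolding can_add_def by (auto split: if_splits)
  next
    case False
    then have "int c \<le> f (x + 1)" "f x < int c" "x < 0" "int c - 1 \<le> f (x - 1)"
      using below out left pos by (auto simp: x_def min_def of_nat_diff split: if_splits)
    then show ?thesis using step False unfolding can_add_def by (auto split: if_splits)
  qed
  then show ?R using pos by (simp add: x_def)
next
  let ?x = "int c - int r"
  assume R: ?R
  have "diagram (raise (\<lambda>y. y = ?x) f) = insert (r, c) (diagram f)"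
  proof (intro Set.set_eqI, clarify)
    fix r' c'
    show "(r', c') \<in> diagram (raise (\<lambda>y. y = ?x) f) \<longleftrightarrow> (r', c') \<in> insert (r, c) (diagram f)"
    proof (cases "int c' - int r' = ?x")
      case True
      then have "(r', c') = (r, c) \<longleftrightarrow> int (min r' c') = int (min r c)" by (auto simp: min_def)
      then show ?thesis using R True by (auto simp: mem_diagram raise_def)
    next
      case False
      then show ?thesis by (auto simp: mem_diagram raise_def)
    qed
  qed
  moreover have "is_diagram (diagram (raise (\<lambda>y. y = ?x) f))"
    using is_diagram_diagram raise_profile[OF assms] by blast
  moreover have "(r, c) \<notin> diagram f" using R by (simp add: mem_diagram)
  ultimately show ?L by simp
qed

lemma is_diagram_remove:
  assumes "profile f"
  shows "(r, c) \<in> diagram f \<and> is_diagram (diagram f - {(r, c)}) \<longleftrightarrow>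
    1 \<le> r \<and> 1 \<le> c \<and> can_remove f (int c - int r) \<and> int (min r c) = f (int c - int r)" (is "?L \<longleftrightarrow> ?R")
proof
  define x where "x = int c - int r"
  assume L: ?L
  then have pos: "1 \<le> r" "1 \<le> c" and inside: "int (min r c) \<le> f x"
    by (simp_all add: mem_diagram x_def)
  have right: "f (x + 1) < int (min r (c + 1))"
  proof -
    have "(r, c + 1) \<notin> diagram f"
      using is_diagram_down[OF conjunct2[OF L], of r "c + 1" r c] pos by auto
    moreover have "int (c + 1) - int r = x + 1" by (simp add: x_def)
    ultimately show ?thesis using pos(1) unfolding mem_diagram by (metis le_add2 not_le)
  qed
  have above: "f (x - 1) < int (min (r + 1) c)"
  proof -
    have "(r + 1, c) \<notin> diagram f"
      using is_diagram_down[OF conjunct2[OF L], of "r + 1" c r c] pos by auto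
    moreover have "int c - int (r + 1) = x - 1" by (simp add: x_def)
    ultimately show ?thesis using pos(2) unfolding mem_diagram by (metis le_add2 not_le)
  qed
  have step: "f x - f (x + 1) + (if x < 0 then 1 else 0) = (if bead f x then 1 else 0)"
    "f (x - 1) - f x + (if x - 1 < 0 then 1 else 0) = (if bead f (x - 1) then 1 else 0)"
    using profile_step[OF assms, of x] profile_step[OF assms, of "x - 1"] by simp_all
  have "can_remove f x \<and> int (min r c) = f x"
  proof (cases "r \<le> c")
    case True
    then have "f (x + 1) < int r" "int r \<le> f x" "x \<ge> 0"
      "f (x - 1) + (if x - 1 < 0 then 1 else 0) \<le> int r"
      using right above inside by (auto simp: x_def min_def split: if_splits)
    then show ?thesis using step True unfolding can_remove_def by (auto split: if_splits)
  next
    case False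
    then have "f (x + 1) \<le> int c" "int c \<le> f x" "x < 0" "f (x - 1) < int c"
      using right above inside by (auto simp: x_def min_def split: if_splits)
    then show ?thesis using step False unfolding can_remove_def by (auto split: if_splits)
  qed
  then show ?R using pos by (simp add: x_def)
next
  let ?x = "int c - int r"
  assume R: ?R
  have "diagram (lower (\<lambda>y. y = ?x) f) = diagram f - {(r, c)}"
  proof (intro Set.set_eqI, clarify)
    fix r' c'
    show "(r', c') \<in> diagram (lower (\<lambda>y. y = ?x) f) \<longleftrightarrow> (r', c') \<in> diagram f - {(r, c)}"
    proof (cases "int c' - int r' = ?x")
      case True
      then have "(r', c') = (r, c) \<longleftrightarrow> int (min r' c') = int (min r c)" by (auto simp: min_def)
      then show ?thesis using R True by (auto simp: mem_diagram lower_def)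
    next
      case False
      then show ?thesis by (auto simp: mem_diagram lower_def)
    qed
  qed
  moreover have "is_diagram (diagram (lower (\<lambda>y. y = ?x) f))"
    using is_diagram_diagram lower_profile[OF assms] by blast
  moreover have "(r, c) \<in> diagram f" using R by (simp add: mem_diagram)
  ultimately show ?L by simp
qed

lemma addable_iff:
  assumes "profile f" "dg \<mu> = diagram f"
  shows "(r, c) \<in> addable \<mu> \<longleftrightarrow>
    1 \<le> r \<and> 1 \<le> c \<and> can_add f (int c - int r) \<and> int (min r c) = f (int c - int r) + 1"
  unfolding addable_def mem_Collect_eq assms(2) by (rule is_diagram_insert[OF assms(1)])

lemma removable_iff:
  assumes "profile f" "dg \<mu> = diagram f"
  shows "(r, c) \<in> removable \<mu> \<longleftrightarrow>
    1 \<le> r \<and> 1 \<le> c \<and> can_remove f (int c - int r) \<and> int (min r c) = f (int c - int r)"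
  unfolding removable_def mem_Collect_eq assms(2) by (rule is_diagram_remove[OF assms(1)])

lemma box_on_diagonal:
  assumes "1 \<le> k"
  obtains r c where "1 \<le> r" "1 \<le> c" "int c - int r = x" "int (min r c) = k"
proof (cases "x \<ge> 0")
  case True
  then show ?thesis using assms that[of "nat k" "nat (k + x)"] by (simp add: min_def)
next
  case False
  then show ?thesis using assms that[of "nat (k - x)" "nat k"] by (simp add: min_def)
qed

lemma can_remove_pos:
  assumes "profile f" "can_remove f x"
  shows "1 \<le> f x"
  using assms(2) profile_step[OF assms(1), of x] profile_step[OF assms(1), of "x - 1"]
    profile_pos[OF assms(1), of "x + 1"] profile_pos[OF assms(1), of "x - 1"]
  unfolding can_remove_def by (auto split: if_splits)

lemma ex_addable_iff:
  assumes "profile f" "dg \<mu> = diagram f"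
  shows "(\<exists>b \<in> addable \<mu>. P (content b)) \<longleftrightarrow> (\<exists>x. P x \<and> can_add f x)"
proof
  assume "\<exists>b \<in> addable \<mu>. P (content b)"
  then obtain r c where "(r, c) \<in> addable \<mu>" "P (int c - int r)" by (auto simp: content_def)
  then show "\<exists>x. P x \<and> can_add f x" using addable_iff[OF assms] by blast
next
  assume "\<exists>x. P x \<and> can_add f x"
  then obtain x where x: "P x" "can_add f x" by blast
  moreover have "1 \<le> f x + 1" using profile_pos[OF assms(1)] by simp
  then obtain r c where "1 \<le> r" "1 \<le> c" "int c - int r = x" "int (min r c) = f x + 1"
    using box_on_diagonal by blast
  ultimately have "(r, c) \<in> addable \<mu> \<and> P (content (r, c))"
    by (simp add: addable_iff[OF assms] content_def)
  then show "\<exists>b \<in> addable \<mu>. P (content b)" by blast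
qed

lemma ex_removable_iff:
  assumes "profile f" "dg \<mu> = diagram f"
  shows "(\<exists>b \<in> removable \<mu>. P (content b)) \<longleftrightarrow> (\<exists>x. P x \<and> can_remove f x)"
proof
  assume "\<exists>b \<in> removable \<mu>. P (content b)"
  then obtain r c where "(r, c) \<in> removable \<mu>" "P (int c - int r)" by (auto simp: content_def)
  then show "\<exists>x. P x \<and> can_remove f x" using removable_iff[OF assms] by blast
next
  assume "\<exists>x. P x \<and> can_remove f x"
  then obtain x where x: "P x" "can_remove f x" by blast
  moreover from this obtain r c where "1 \<le> r" "1 \<le> c" "int c - int r = x" "int (min r c) = f x"
    using box_on_diagonal[OF can_remove_pos[OF assms(1)]] by blast
  ultimately have "(r, c) \<in> removable \<mu> \<and> P (content (r, c))"
    by (simp add: removable_iff[OF assms] content_def)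
  then show "\<exists>b \<in> removable \<mu>. P (content b)" by blast
qed

lemma diagram_raise:
  assumes "profile f" "dg \<mu> = diagram f"
  shows "dg \<mu> \<union> {b \<in> addable \<mu>. X (content b)} = diagram (raise X f)"
proof (intro Set.set_eqI, clarify)
  fix r c
  show "(r, c) \<in> dg \<mu> \<union> {b \<in> addable \<mu>. X (content b)} \<longleftrightarrow> (r, c) \<in> diagram (raise X f)"
    by (auto simp: assms(2) addable_iff[OF assms] content_def mem_diagram raise_def)
qed

lemma diagram_lower:
  assumes "profile f" "dg \<mu> = diagram f"
  shows "dg \<mu> - {b \<in> removable \<mu>. X (content b)} = diagram (lower X f)"
proof (intro Set.set_eqI, clarify)
  fix r c
  show "(r, c) \<in> dg \<mu> - {b \<in> removable \<mu>. X (content b)} \<longleftrightarrow> (r, c) \<in> diagram (lower X f)"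
    by (auto simp: assms(2) removable_iff[OF assms] content_def mem_diagram lower_def)
qed

section \<open>The action on profiles, containment and marked boxes\<close>

lemma has_residue_pm_iff: "has_residue_pm n i b \<longleftrightarrow> wall n i (content b)"
proof -
  have "content b - (2 * int n - int i) = (content b + int i) - 2 * int n" by simp
  then have "2 * int n dvd content b - (2 * int n - int i) \<longleftrightarrow> 2 * int n dvd content b + int i"
    by (metis dvd_diff_left_iff dvd_refl)
  then show ?thesis unfolding has_residue_pm_def wall_def cong_iff_dvd_diff by blast
qed

lemma has_residue_iff: "has_residue n i b \<longleftrightarrow> 2 * int n dvd content b - int i"
  unfolding has_residue_def cong_iff_dvd_diff ..

lemma act_gen_profile:
  assumes "is_partition \<mu>" "profile f" "dg \<mu> = diagram f"
  shows "is_partition (act_gen n i \<mu>) \<and> dg (act_gen n i \<mu>) =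
    diagram (if \<exists>x. 2 * int n dvd x - int i \<and> can_add f x then raise (wall n i) f
      else if \<exists>x. 2 * int n dvd x - int i \<and> can_remove f x then lower (wall n i) f else f)"
  using assms partition_of_diagram[OF is_diagram_diagram[OF conjunct1[OF raise_profile[OF assms(2), of "wall n i"]]]]
    partition_of_diagram[OF is_diagram_diagram[OF conjunct1[OF lower_profile[OF assms(2), of "wall n i"]]]]
  unfolding act_gen_def has_residue_iff has_residue_pm_iff ex_addable_iff[OF assms(2,3), of "\<lambda>x. 2 * int n dvd x - int i"]
    ex_removable_iff[OF assms(2,3), of "\<lambda>x. 2 * int n dvd x - int i"]
    diagram_raise[OF assms(2,3), of "wall n i"] diagram_lower[OF assms(2,3), of "wall n i"]
  by auto

text \<open>Only diagonals on which \<open>f\<close> and \<open>g\<close> agree matter. There a box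
  removable from \<open>g\<close> is also removable from \<open>f\<close>, because the adjacent
  diagonals of \<open>f\<close> are no longer than those of \<open>g\<close>.\<close>

lemma lower_mono:
  assumes "profile f" "profile g" "\<And>x. f x \<le> g x"
  shows "lower X f x \<le> lower X g x"
  using assms(3)[of x] assms(3)[of "x + 1"] assms(3)[of "x - 1"]
    profile_step[OF assms(1), of x] profile_step[OF assms(1), of "x - 1"]
    profile_step[OF assms(2), of x] profile_step[OF assms(2), of "x - 1"]
  unfolding lower_def can_remove_def by (auto split: if_splits)

text \<open>The right neighbour lies outside \<open>g\<close>, so the boundary of \<open>g\<close>
  runs vertically along the right side of the box. The lower neighbour, if any, already lies in
  \<open>f\<close> but the box does not, so the boundary of \<open>f\<close> runs horizontally below
  it. Both steps have the content of the box.\<close>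

lemma southeast_box_bead:
  assumes "profile f" "profile g" "most_southeast R (r, c)" "R \<in> box_components (diagram g - diagram f)"
  shows "bead g (int c - int r)" "\<not> bead f (int c - int r)"
proof -
  define x where "x = int c - int r"
  let ?S = "diagram g - diagram f"
  obtain a where R: "R = {b. (a, b) \<in> {(x, y). x \<in> ?S \<and> y \<in> ?S \<and> adjacent x y}\<^sup>*}" and a: "a \<in> ?S"
    using assms(4) unfolding box_components_def by blast
  have rc: "(r, c) \<in> R" "\<And>b. b \<in> R \<Longrightarrow> r \<le> fst b \<and> snd b \<le> c"
    using assms(3) unfolding most_southeast_def by auto
  have sub: "b \<in> ?S" if "b \<in> R" for b
    using that a unfolding R by (auto elim: rtranclE)
  have closed: "b' \<in> R" if "b \<in> R" "b' \<in> ?S" "adjacent b b'" for b b'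
    using that sub[OF that(1)] unfolding R by (auto intro: rtrancl_into_rtrancl)
  have S: "(r, c) \<in> ?S" using sub rc by blast
  then have pos: "1 \<le> r" "1 \<le> c" "int (min r c) \<le> g x" "f x < int (min r c)"
    by (auto simp: mem_diagram x_def)
  \<comment> \<open>A neighbour in the skew diagram would belong to the same component, beyond its
    extreme box.\<close>
  have right: "(r, c + 1) \<notin> ?S"
    using closed[OF rc(1), of "(r, c + 1)"] rc(2)[of "(r, c + 1)"] by (auto simp: adjacent_def)
  have below: "(r - 1, c) \<notin> ?S"
  proof
    assume "(r - 1, c) \<in> ?S"
    then have "(r - 1, c) \<in> R" using closed[OF rc(1)] pos by (auto simp: adjacent_def)
    then have "r \<le> r - 1" using rc(2) by fastforce
    then show False using pos by simp
  qed
  have "(r, c + 1) \<notin> diagram f"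
    using is_diagram_down[OF is_diagram_diagram[OF assms(1)], of r "c + 1" r c] pos S by auto
  then have "(r, c + 1) \<notin> diagram g" using right by blast
  moreover have "int (c + 1) - int r = x + 1" by (simp add: x_def)
  ultimately have "g (x + 1) < int (min r (c + 1))"
    using pos(1) unfolding mem_diagram by (metis le_add2 not_le)
  then show "bead g (int c - int r)"
    using pos profile_step[OF assms(2), of x] unfolding x_def[symmetric]
    by (auto simp: min_def x_def[symmetric] split: if_splits) (auto simp: x_def)
  have "int (min (r - 1) c) \<le> f (x + 1)"
  proof (cases "r = 1")
    case False
    then have "(r - 1, c) \<in> diagram g"
      using is_diagram_down[OF is_diagram_diagram[OF assms(2)], of r c "r - 1" c] pos S by auto
    then have "(r - 1, c) \<in> diagram f" using below by blast
    moreover have "int c - int (r - 1) = x + 1" using pos by (simp add: x_def of_nat_diff)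
    ultimately show ?thesis by (simp add: mem_diagram)
  qed (use profile_pos[OF assms(1), of "x + 1"] in simp)
  then show "\<not> bead f (int c - int r)"
    using pos profile_step[OF assms(1), of x] unfolding x_def[symmetric]
    by (auto simp: min_def x_def[symmetric] of_nat_diff split: if_splits) (auto simp: x_def)
qed

section \<open>Cores of Grassmannian elements\<close>

definition core_profile :: "nat \<Rightarrow> (int \<Rightarrow> int) \<Rightarrow> (int \<Rightarrow> int) \<Rightarrow> bool" where
  "core_profile n w f \<longleftrightarrow> profile f \<and> (\<forall>x. bead f x \<longleftrightarrow> skip n x \<in> w ` {..<0})"

section \<open>Symmetry of cores and the effect of one generator\<close>

lemma core_profile_bead:
  assumes "core_profile n w f" "bij w"
  shows "bead f x \<longleftrightarrow> perm_inv w (skip n x) < 0"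
proof -
  have "y \<in> w ` {..<0} \<longleftrightarrow> perm_inv w y < 0" for y
    using assms(2) by (auto simp: bij_is_inj) (metis bij_inv_eq_iff imageI lessThan_iff)
  then show ?thesis using assms(1) by (simp add: core_profile_def)
qed

lemma core_profile_profile: "core_profile n w f \<Longrightarrow> profile f"
  by (simp add: core_profile_def)

text \<open>Translation adds the same amount to both values; negation exchanges the two sides of a
  wall and changes both signs. Hence all walls of a generator show a step in the same
  direction.\<close>

lemma wall_difference:
  assumes "equivariant n v" "n > 0" "wall n a p" "wall n a q"
  shows "v (skip n q) - v (skip n (q - 1)) = v (skip n p) - v (skip n (p - 1))"
  using assms(3,4)
proof (cases rule: wall_cases)
  case (1 k)
  then have "q - 1 = (p - 1) + 2 * int n * k" by simp
  then have "v (skip n (q - 1)) = v (skip n (p - 1)) + (2 * int n + 2) * k"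
    using equivariant_skip_add[OF assms(1,2)] by metis
  then show ?thesis using 1 equivariant_skip_add[OF assms(1,2), of p k] by simp
next
  case (2 k)
  have "skip n (- p) = - skip n (p - 1)" "skip n (- p - 1) = - skip n p"
    using skip_reflect[OF assms(2), of "p - 1"] skip_reflect[OF assms(2), of p]
      minus_diff_commute[of 1 p] by simp_all
  then have "v (skip n (- p)) = - v (skip n (p - 1))" "v (skip n (- p - 1)) = - v (skip n p)"
    using equivariant_uminus[OF assms(1)] by simp_all
  moreover have "q - 1 = (- p - 1) + 2 * int n * k" using 2 by simp
  then have "v (skip n (q - 1)) = v (skip n (- p - 1)) + (2 * int n + 2) * k"
    using equivariant_skip_add[OF assms(1,2)] by metis
  ultimately show ?thesis using 2 equivariant_skip_add[OF assms(1,2), of "- p" k] by simp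
qed

text \<open>An addable box is an increase of the inverse of \<open>w\<close> at a wall, a removable
  box a decrease, and by \<open>wall_difference\<close> one generator cannot see both.\<close>

lemma not_add_and_remove:
  assumes "n > 0" "equivariant n w" "core_profile n w f"
    and "wall n a p" "wall n a q" "can_add f p" "can_remove f q"
  shows False
proof -
  note bead = core_profile_bead[OF assms(3) equivariant_bij[OF assms(2)]]
  have "perm_inv w (skip n p) > perm_inv w (skip n (p - 1))"
    using assms(6) unfolding can_add_def bead by simp
  moreover have "perm_inv w (skip n q) < perm_inv w (skip n (q - 1))"
    using assms(7) unfolding can_remove_def bead by simp
  ultimately show False
    using wall_difference[OF equivariant_inv[OF assms(2)] assms(1,4,5)] by simp
qed

text \<open>The symmetry of the core about the main diagonal, which comes from \<open>w\<close>
  being an odd function.\<close>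

lemma bead_reflect:
  assumes "n > 0" "equivariant n w" "core_profile n w f"
  shows "bead f (- 1 - x) \<longleftrightarrow> \<not> bead f x"
proof -
  note bead = core_profile_bead[OF assms(3) equivariant_bij[OF assms(2)]]
  obtain y where y: "perm_inv w (skip n x) = skip n y"
    using equivariant_skip_cases[OF equivariant_inv[OF assms(2)] assms(1)] by blast
  have "perm_inv w (skip n (- 1 - x)) = - skip n y"
    using y skip_reflect[OF assms(1)] equivariant_uminus[OF equivariant_inv[OF assms(2)]] by simp
  moreover have "skip n y \<noteq> 0" using not_dvd_skip[OF assms(1), of y] by auto
  ultimately show ?thesis unfolding bead y by auto
qed

text \<open>\<open>act_gen\<close> tests for residue \<open>i\<close> but changes boxes of residue
  \<open>i\<close> and \<open>- i\<close>; the symmetry of the core bridges the difference.\<close>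

lemma ex_residue_iff_ex_wall:
  assumes "\<And>x. P (- x) \<longleftrightarrow> P x"
  shows "(\<exists>x. 2 * int n dvd x - int i \<and> P x) \<longleftrightarrow> (\<exists>x. wall n i x \<and> P x)"
proof
  assume "\<exists>x. wall n i x \<and> P x"
  then obtain x where x: "wall n i x" "P x" by blast
  show "\<exists>x. 2 * int n dvd x - int i \<and> P x"
  proof (cases "2 * int n dvd x - int i")
    case False
    then have "2 * int n dvd - (x + int i)" using x(1) unfolding wall_def dvd_minus_iff by blast
    then have "2 * int n dvd - x - int i" by simp
    then show ?thesis using x(2) assms by blast
  qed (use x in blast)
qed (auto simp: wall_def)

lemma skip_mem_image_sgen_comp_iff:
  assumes "n \<ge> 2" "a \<le> n"
  shows "skip n x \<in> (sgen n a \<circ> w) ` {..<0} \<longleftrightarrow> skip n (swap n a x) \<in> w ` {..<0}"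
proof -
  have "skip n x \<in> sgen n a ` S \<longleftrightarrow> sgen n a (skip n x) \<in> S" for S
    using sgen_sgen[OF assms] by (metis image_iff)
  then show ?thesis unfolding image_comp[symmetric] sgen_skip[OF assms] by blast
qed

text \<open>With no removable box at the walls, moving beads up is the same as exchanging positions
  \<open>p - 1\<close> and \<open>p\<close> at every wall \<open>p\<close>: where both are beads or
  both are gaps, the exchange changes nothing.\<close>

lemma core_profile_raise:
  assumes "n \<ge> 2" "a \<le> n" "core_profile n w f" "\<And>p. wall n a p \<Longrightarrow> \<not> can_remove f p"
  shows "core_profile n (sgen n a \<circ> w) (raise (wall n a) f)"
proof -
  note raise = raise_profile[OF core_profile_profile[OF assms(3)], of "wall n a"]
  have "bead (raise (wall n a) f) x \<longleftrightarrow> bead f (swap n a x)" for x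
    using raise wall_not_adjacent[OF assms(1), of a x] assms(4)[of x] assms(4)[of "x + 1"]
    unfolding swap_def can_add_def can_remove_def by auto
  then show ?thesis using raise assms(3) skip_mem_image_sgen_comp_iff[OF assms(1,2)]
    unfolding core_profile_def by blast
qed

lemma core_profile_lower:
  assumes "n \<ge> 2" "a \<le> n" "core_profile n w f" "\<And>p. wall n a p \<Longrightarrow> \<not> can_add f p"
  shows "core_profile n (sgen n a \<circ> w) (lower (wall n a) f)"
proof -
  note lower = lower_profile[OF core_profile_profile[OF assms(3)], of "wall n a"]
  have "bead (lower (wall n a) f) x \<longleftrightarrow> bead f (swap n a x)" for x
    using lower wall_not_adjacent[OF assms(1), of a x] assms(4)[of x] assms(4)[of "x + 1"]
    unfolding swap_def can_add_def can_remove_def by auto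
  then show ?thesis using lower assms(3) skip_mem_image_sgen_comp_iff[OF assms(1,2)]
    unfolding core_profile_def by blast
qed

lemma core_profile_id: "n > 0 \<Longrightarrow> core_profile n id (\<lambda>_. 0)"
  unfolding core_profile_def using profile_zero skip_neg_iff by auto

text \<open>Holds for every word, reduced or not, so it applies to whichever word \<open>act\<close>
  chooses.\<close>

lemma foldr_act_gen_profile:
  assumes "n \<ge> 2" "set ws \<subseteq> {0..n}"
  shows "\<exists>f. is_partition (foldr (act_gen n) ws []) \<and> dg (foldr (act_gen n) ws []) = diagram f \<and>
    core_profile n (word_perm n ws) f"
  using assms(2)
proof (induction ws)
  case Nil
  have "is_partition []" "dg [] = {}" by (auto simp: is_partition_def dg_def)
  moreover have "core_profile n (word_perm n []) (\<lambda>_. 0)"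
    using core_profile_id[of n] assms(1) unfolding word_perm_Nil by simp
  ultimately show ?case
    unfolding foldr_Nil id_apply by (intro exI[of _ "\<lambda>_. 0"]) (simp only: diagram_zero simp_thms)
next
  case (Cons a ws)
  let ?\<mu> = "foldr (act_gen n) ws []" and ?w = "word_perm n ws"
  have a: "a \<le> n" "set ws \<subseteq> {0..n}" and n: "n > 0" using Cons.prems assms(1) by auto
  then obtain f where f: "is_partition ?\<mu>" "dg ?\<mu> = diagram f" "core_profile n ?w f"
    using Cons.IH by blast
  have w: "equivariant n ?w" using equivariant_word_perm[OF assms(1) a(2)] .
  have reflect: "bead f (- x - 1) \<longleftrightarrow> \<not> bead f x" "bead f (- x) \<longleftrightarrow> \<not> bead f (x - 1)" for x
    using bead_reflect[OF n w f(3), of x] bead_reflect[OF n w f(3), of "x - 1"]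
      minus_diff_commute[of 1 x] by simp_all
  have res: "(\<exists>x. 2 * int n dvd x - int a \<and> can_add f x) \<longleftrightarrow> (\<exists>x. wall n a x \<and> can_add f x)"
    "(\<exists>x. 2 * int n dvd x - int a \<and> can_remove f x) \<longleftrightarrow> (\<exists>x. wall n a x \<and> can_remove f x)"
    by (rule ex_residue_iff_ex_wall, unfold can_add_def can_remove_def reflect, blast)+
  note act = act_gen_profile[OF f(1) core_profile_profile[OF f(3)] f(2), of n a, unfolded res]
  show ?case
  proof (cases "\<exists>x. wall n a x \<and> can_add f x")
    case True
    then have "core_profile n (sgen n a \<circ> ?w) (raise (wall n a) f)"
      using core_profile_raise[OF assms(1) a(1) f(3)] not_add_and_remove[OF n w f(3)] by blast
    moreover have "is_partition (act_gen n a ?\<mu>)" "dg (act_gen n a ?\<mu>) = diagram (raise (wall n a) f)"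
      using act True by simp_all
    ultimately show ?thesis unfolding foldr_Cons o_apply word_perm_Cons by blast
  next
    case False
    then have "core_profile n (sgen n a \<circ> ?w) (lower (wall n a) f)"
      using core_profile_lower[OF assms(1) a(1) f(3)] by blast
    \<comment> \<open>The idle branch of \<open>act_gen\<close> is \<open>lower\<close> with nothing
      to remove.\<close>
    moreover have "lower (wall n a) f = f" if "\<not> (\<exists>x. wall n a x \<and> can_remove f x)"
      using that by (auto simp: lower_def)
    then have "is_partition (act_gen n a ?\<mu>)" "dg (act_gen n a ?\<mu>) = diagram (lower (wall n a) f)"
      using act False by (simp_all split: if_splits)
    ultimately show ?thesis unfolding foldr_Cons o_apply word_perm_Cons by blast
  qed
qed

lemma core_of_profile:
  assumes "n \<ge> 2" "w \<in> affC n"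
  obtains f where "core_profile n w f" "dg (core_of n w) = diagram f"
proof -
  define ws where "ws = (SOME ws. is_word n ws w)"
  have "\<exists>ws. is_word n ws w" using assms affC_iff by blast
  then have "is_word n ws w" unfolding ws_def by (rule someI_ex)
  then have ws: "set ws \<subseteq> {0..n}" "word_perm n ws = w" by (simp_all add: is_word_def)
  have core: "core_of n w = foldr (act_gen n) ws []" by (simp add: core_of_def act_def ws_def)
  obtain f where "core_profile n w f" "dg (core_of n w) = diagram f"
    using foldr_act_gen_profile[OF assms(1) ws(1)] unfolding ws(2) core by blast
  then show thesis by (rule that)
qed

lemma affC0_profile_eqI:
  assumes "n \<ge> 2" "w \<in> affC0 n" "u \<in> affC0 n" "core_profile n w f" "core_profile n u f"
  shows "w = u"
  using affC0_eqI[OF assms(1-3)] assms(4,5) unfolding core_profile_def by blast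

text \<open>This makes \<open>elt_of_core\<close>, an \<open>inv_into\<close>, return the given
  Grassmannian elements.\<close>

lemma inj_on_core_of:
  assumes "n \<ge> 2"
  shows "inj_on (core_of n) (affC0 n)"
proof (rule inj_onI)
  fix w u
  assume w: "w \<in> affC0 n" and u: "u \<in> affC0 n" and eq: "core_of n w = core_of n u"
  obtain f where f: "core_profile n w f" "dg (core_of n w) = diagram f"
    using core_of_profile[OF assms affC0_affC[OF w]] .
  obtain g where g: "core_profile n u g" "dg (core_of n u) = diagram g"
    using core_of_profile[OF assms affC0_affC[OF u]] .
  have p: "profile f" "profile g" using f(1) g(1) core_profile_profile by blast+
  have "diagram f = diagram g" using f g eq by simp
  then have "f = g"
    using diagram_mono[OF p] diagram_mono[OF p(2,1)] by (intro ext antisym) auto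
  then show "w = u" using affC0_profile_eqI[OF assms w u f(1)] g(1) by simp
qed

text \<open>A bead at \<open>p\<close> after a gap at \<open>p - 1\<close> means that the inverse of
  \<open>w\<close> is negative at the former and nonnegative at the latter, hence decreasing
  there.\<close>

lemma can_remove_descent:
  assumes "n \<ge> 2" "a \<le> n" "w \<in> affC n" "core_profile n w f" "wall n a p" "can_remove f p"
  shows "cox_length n (sgen n a \<circ> w) < cox_length n w"
proof -
  note bead = core_profile_bead[OF assms(4) equivariant_bij[OF equivariant_affC[OF assms(1,3)]]]
  show ?thesis
    using assms(6) unfolding can_remove_def bead
    by (intro cox_length_descent_left[OF assms(1,2,5,3)]) simp
qed

text \<open>The lifting property: a first letter of a reduced word of the larger element is
  either a descent of the smaller one as well, and can be cancelled from both, or it can be removed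
  from the larger element alone without destroying the containment of the cores.\<close>

lemma cover_conjugate_generator:
  assumes "n \<ge> 2" "w \<in> affC0 n" "u \<in> affC0 n" "core_profile n w f" "core_profile n u g"
    and "\<And>x. f x \<le> g x" "cox_length n u = k"
  shows "cox_length n w \<le> k \<and> (cox_length n w = k \<longrightarrow> w = u) \<and>
    (k = Suc (cox_length n w) \<longrightarrow>
      (\<exists>v a. equivariant n v \<and> a \<le> n \<and> u = w \<circ> (perm_inv v \<circ> sgen n a \<circ> v)))"
  using assms(2-7)
proof (induction k arbitrary: w u f g)
  case 0
  have n: "n > 0" using assms(1) by simp
  obtain ws where "is_word n ws u" "length ws = 0"
    using reduced_word[OF assms(1) affC0_affC[OF 0(2)]] 0(6) by metis
  then have u: "u = id" by (simp add: is_word_def)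
  have "g = (\<lambda>_. 0)"
    using 0(4) core_profile_id[OF n] unfolding u core_profile_def by (intro profile_eqI) auto
  then have "f = g"
    using 0(5) profile_pos[OF core_profile_profile[OF 0(3)]] by (intro ext antisym) auto
  then have "w = u" using affC0_profile_eqI[OF assms(1) 0(1,2,3)] 0(4) by simp
  then show ?case using 0(6) by simp
next
  case (Suc k)
  have n: "n > 0" using assms(1) by simp
  have affC: "w \<in> affC n" "u \<in> affC n" using Suc.prems affC0_affC by blast+
  note equi = equivariant_affC[OF assms(1) affC(1)] equivariant_affC[OF assms(1) affC(2)]
  obtain ws where ws: "is_word n ws u" "length ws = Suc k"
    using reduced_word[OF assms(1) affC(2)] Suc.prems(6) by metis
  then obtain a vs where "ws = a # vs" by (cases ws) auto
  then have a: "a \<le> n" "set vs \<subseteq> {0..n}" "u = sgen n a \<circ> word_perm n vs" "length vs = k"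
    using ws by (auto simp: is_word_def)
  define u' where "u' = sgen n a \<circ> u"
  have cancel: "sgen n a \<circ> (sgen n a \<circ> v) = v" for v
    using sgen_comp_sgen[OF assms(1) a(1)] by (simp add: comp_assoc[symmetric])
  have "is_word n vs u'" using a unfolding is_word_def u'_def by (simp add: cancel)
  then have less: "cox_length n (sgen n a \<circ> u) < cox_length n u"
    using cox_length_le[of n vs u'] a(4) Suc.prems(6) by (simp add: u'_def)
  have u': "u' \<in> affC0 n" "cox_length n u' = k"
    using affC0_descent[OF assms(1) a(1) Suc.prems(2) less] Suc.prems(6) by (simp_all add: u'_def)
  \<comment> \<open>An addable box here would become a removable box of the core of
    \<open>u'\<close>, making \<open>s_a u' = u\<close> shorter than \<open>u'\<close>.\<close>
  have "\<not> can_add g p" if p: "wall n a p" for p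
  proof
    assume add: "can_add g p"
    have "core_profile n u' (raise (wall n a) g)"
      unfolding u'_def using not_add_and_remove[OF n equi(2) Suc.prems(4) p _ add]
      by (intro core_profile_raise[OF assms(1) a(1) Suc.prems(4)]) blast
    moreover have "can_remove (raise (wall n a) g) p"
      using raise_profile[OF core_profile_profile[OF Suc.prems(4)], of "wall n a"] add p
        wall_not_adjacent[OF assms(1), of a "p - 1"]
      unfolding can_remove_def can_add_def by auto
    ultimately have "cox_length n (sgen n a \<circ> u') < cox_length n u'"
      using can_remove_descent[OF assms(1) a(1) affC0_affC[OF u'(1)] _ p] by blast
    then show False using less by (simp add: u'_def cancel)
  qed
  then have g': "core_profile n u' (lower (wall n a) g)"
    unfolding u'_def by (rule core_profile_lower[OF assms(1) a(1) Suc.prems(4)])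
  have mono: "lower (wall n a) f x \<le> lower (wall n a) g x" for x
    using lower_mono core_profile_profile Suc.prems(3-5) by blast
  show ?case
  proof (cases "\<exists>p. wall n a p \<and> can_remove f p")
    case True
    then obtain p where p: "wall n a p" "can_remove f p" by blast
    define w' where "w' = sgen n a \<circ> w"
    have "core_profile n w' (lower (wall n a) f)"
      unfolding w'_def using not_add_and_remove[OF n equi(1) Suc.prems(3) _ p(1) _ p(2)]
      by (intro core_profile_lower[OF assms(1) a(1) Suc.prems(3)]) blast
    moreover have w': "w' \<in> affC0 n" "cox_length n w = Suc (cox_length n w')"
      using affC0_descent[OF assms(1) a(1) Suc.prems(1)]
        can_remove_descent[OF assms(1) a(1) affC(1) Suc.prems(3) p] by (simp_all add: w'_def)
    ultimately have IH: "cox_length n w' \<le> k" "cox_length n w' = k \<Longrightarrow> w' = u'"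
      "k = Suc (cox_length n w') \<Longrightarrow>
        \<exists>v b. equivariant n v \<and> b \<le> n \<and> u' = w' \<circ> (perm_inv v \<circ> sgen n b \<circ> v)"
      using Suc.IH[OF _ u'(1) _ g' mono u'(2)] by blast+
    have undo: "sgen n a \<circ> w' = w" "sgen n a \<circ> u' = u" by (simp_all add: w'_def u'_def cancel)
    \<comment> \<open>Cancelling \<open>s_a\<close> on the left of both elements does not change
      their quotient, so the same \<open>v\<close> and \<open>b\<close> work.\<close>
    have conj: "\<exists>v b. equivariant n v \<and> b \<le> n \<and> u = w \<circ> (perm_inv v \<circ> sgen n b \<circ> v)"
      if "k = Suc (cox_length n w')"
      using IH(3)[OF that] undo by (metis comp_assoc)
    show ?thesis
    proof (intro conjI impI)
      show "cox_length n w \<le> Suc k" using IH(1) w'(2) by simp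
      show "w = u" if "cox_length n w = Suc k"
      proof -
        have "w' = u'" using IH(2) w'(2) that by simp
        then have "sgen n a \<circ> w' = sgen n a \<circ> u'" by (rule arg_cong)
        then show ?thesis unfolding undo .
      qed
      show "\<exists>v b. equivariant n v \<and> b \<le> n \<and> u = w \<circ> (perm_inv v \<circ> sgen n b \<circ> v)"
        if "Suc k = Suc (cox_length n w)"
        by (rule conj) (use that w'(2) in simp)
    qed
  next
    case False
    \<comment> \<open>Removing boxes from \<open>g\<close> alone keeps \<open>f\<close> below it, so
      the hypothesis compares \<open>w\<close> itself with \<open>u'\<close>. In the cover case
      their lengths agree, hence \<open>w = u'\<close> and the quotient is \<open>s_a\<close>
      conjugated by \<open>w\<close>.\<close>
    then have "lower (wall n a) f = f" by (auto simp: lower_def)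
    then have IH: "cox_length n w \<le> k" "cox_length n w = k \<Longrightarrow> w = u'"
      using Suc.IH[OF Suc.prems(1) u'(1) Suc.prems(3) g' _ u'(2)] mono by auto
    have "u = w \<circ> (perm_inv w \<circ> sgen n a \<circ> w)" if "cox_length n w = k"
    proof -
      have "u = sgen n a \<circ> w" using IH(2)[OF that] by (simp add: u'_def cancel)
      also have "\<dots> = (w \<circ> perm_inv w) \<circ> (sgen n a \<circ> w)"
        using inv_comp_bij(2)[OF equivariant_bij[OF equi(1)]] by simp
      finally show ?thesis by (simp add: comp_assoc)
    qed
    then show ?thesis using IH(1) equi(1) a(1) by auto
  qed
qed

section \<open>Naming the reflection by the marking\<close>

lemma tC_eqI:
  assumes "t \<in> affC n" "is_transposition n t i j"
  shows "tC n i j = t"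
  unfolding tC_def is_transposition_def[symmetric]
  using assms transposition_unique by (intro the_equality) blast+

theorem theorem3p16:
  fixes n :: nat and \<tau> \<kappa> :: "nat list" and c :: int and w u :: "int \<Rightarrow> int"
  assumes "n \<ge> 2"
    and "strong_marked_cover n \<tau> c \<kappa>"
    and "w \<in> affC0 n" and "u \<in> affC0 n"
    and "\<tau> = core_of n w" and "\<kappa> = core_of n u"
  shows "\<exists>i j :: int.
    \<not> (int n + 1) dvd i \<and> \<not> (int n + 1) dvd j \<and> \<not> [i = j] (mod 2 * int n + 2) \<and>
    u = w \<circ> tC n i j \<and>
    w j = u i \<and> u i = c + \<lfloor>real_of_int c / real n\<rfloor> + 1"
proof -
  have n: "n > 0" using assms(1) by simp
  have affC: "w \<in> affC n" "u \<in> affC n" using assms affC0_affC by blast+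
  note equi = equivariant_affC[OF assms(1) affC(1)] equivariant_affC[OF assms(1) affC(2)]
  note bij = equivariant_bij[OF equi(1)] equivariant_bij[OF equi(2)]
  obtain f where f: "core_profile n w f" "dg \<tau> = diagram f"
    using core_of_profile[OF assms(1) affC(1)] assms(5) by metis
  obtain g where g: "core_profile n u g" "dg \<kappa> = diagram g"
    using core_of_profile[OF assms(1) affC(2)] assms(6) by metis
  have p: "profile f" "profile g" using f(1) g(1) core_profile_profile by blast+
  obtain R b where R: "strong_cover n \<tau> \<kappa>" "R \<in> box_components (diagram g - diagram f)"
    "most_southeast R b" "c = content b"
    using assms(2) f(2) g(2) unfolding strong_marked_cover_def by auto
  have bead: "bead g c" "\<not> bead f c"
    using southeast_box_bead[OF p, of R "fst b" "snd b"] R by (simp_all add: content_def)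
  have le: "f x \<le> g x" for x
    using R(1) f(2) g(2) diagram_mono[OF p] unfolding strong_cover_def by auto
  have "elt_of_core n \<tau> = w" "elt_of_core n \<kappa> = u"
    using inv_into_f_f[OF inj_on_core_of[OF assms(1)]] assms(3-6) by (simp_all add: elt_of_core_def)
  then have len: "cox_length n u = Suc (cox_length n w)"
    using R(1) unfolding strong_cover_def by simp
  obtain v a where va: "equivariant n v" "a \<le> n" "u = w \<circ> (perm_inv v \<circ> sgen n a \<circ> v)"
    using cover_conjugate_generator[OF assms(1,3,4) f(1) g(1) le refl] len by blast
  define t where "t = perm_inv v \<circ> sgen n a \<circ> v"
  have u: "u = w \<circ> t" using va(3) by (simp add: t_def)
  have iv: "perm_inv v (v x) = x" "v (perm_inv v x) = x" for x
    using equivariant_bij[OF va(1)] by (simp_all add: bij_is_inj bij_is_surj surj_f_inv_f)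
  define i j where "i = perm_inv u (skip n c)" and "j = perm_inv w (skip n c)"
  have wj: "w j = skip n c" and ui: "u i = skip n c"
    using bij by (simp_all add: i_def j_def bij_is_surj surj_f_inv_f)
  have "i < 0" "\<not> j < 0"
    using bead core_profile_bead[OF f(1) bij(1)] core_profile_bead[OF g(1) bij(2)]
    by (simp_all add: i_def j_def)
  then have "i \<noteq> j" by auto
  have "w (t i) = w j" using u wj ui by simp
  then have tij: "t i = j" using bij(1) by (metis bij_pointE)
  \<comment> \<open>After conjugation by \<open>v\<close> the reflection is the generator
    \<open>s_a\<close>. A generator that moves a point is the transposition of that point and its
    image, so one moved point suffices to name it.\<close>
  then have move: "sgen n a (v i) = v j" by (auto simp: t_def iv)
  have "v j \<noteq> v i" using \<open>i \<noteq> j\<close> iv by metis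
  then have moved: "is_transposition n (sgen n a) (v i) (v j)" "\<not> [v i = v j] (mod 2 * int n + 2)"
    using sgen_moved[OF assms(1) va(2), of "v i"] unfolding move by auto
  have "is_transposition n t i j"
    using transposition_conj[OF equivariant_inv[OF va(1)] moved(1)]
    by (simp add: iv inv_inv_eq[OF equivariant_bij[OF va(1)]] t_def)
  moreover have "t \<in> affC n"
  proof -
    have "t = perm_inv w \<circ> u"
      unfolding u using inv_comp_bij(1)[OF bij(1)] by (simp add: comp_assoc[symmetric])
    then show ?thesis using affC_comp affC_inv affC assms(1) by simp
  qed
  ultimately have "u = w \<circ> tC n i j" using u tC_eqI by simp
  moreover have "\<not> [i = j] (mod 2 * int n + 2)"
  proof
    assume "[i = j] (mod 2 * int n + 2)"
    then obtain q where "i = j + q * (2 * int n + 2)" by (rule cong_int_obtain)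
    then have "v i = v j + q * (2 * int n + 2)" using equivariant_add[OF va(1)] by simp
    then show False using moved(2) by (simp add: cong_def)
  qed
  moreover have "\<not> (int n + 1) dvd i" "\<not> (int n + 1) dvd j"
    using equivariant_skip_cases[OF equivariant_inv[OF equi(2)] n, of c]
      equivariant_skip_cases[OF equivariant_inv[OF equi(1)] n, of c] not_dvd_skip[OF n]
    unfolding i_def j_def by metis+
  moreover have "skip n c = c + \<lfloor>real_of_int c / real n\<rfloor> + 1"
    using floor_divide_of_int_eq[of c "int n", where 'a = real] by (simp add: skip_def)
  ultimately show ?thesis using wj ui by (intro exI[of _ i] exI[of _ j]) auto
qed

end
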